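(* With the unit vector $\mathbf{d}$ and matrix $\mathbb{E}$ as defined in the context, suppose $\mathbb{E}$ is nonsingular and let $\tilde{\mathbf{\Theta}}=\mathbb{E}^{-1}\tilde{\mathbf{\Phi}}$. Then the function of $\gamma$ $$ \left\langle \delta(\gamma-\gamma_1) \prod_{i=2}^N \tilde{\phi}_i(\gamma_i), (\mathcal{T}+\mathcal{V}) \prod_{i=1}^N \phi_i(\gamma_i) \right\rangle_{\mathcal{A}} $$ is equal to $$ \frac{|\mathbb{E}|}{N!} \left[ \mathbf{\Phi}(\gamma)^* \left( \mathbf{d} \int (\mathcal{T}_*+\mathcal{V}_* )[\mathbf{\Phi}]^*\tilde{\mathbf{\Theta}}\, d\gamma' - \int (\mathcal{T}_*+\mathcal{V}_* )[\mathbf{\Phi}^*\mathbf{d}]\, \tilde{\mathbf{\Theta}}\, d\gamma' \right) + (\mathcal{T}_*+\mathcal{V}_* )[\mathbf{\Phi}^*\mathbf{d}](\gamma) \right], $$ which can be computed with total cost $\mathcal{O}(N^3+N^2M)$.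
   Context: $N\ge1$ is an integer. A particle variable is $\gamma=(\mathbf{r},\sigma)$ with $\mathbf{r}\in\mathbb{R}^3$ and $\sigma\in\{-\frac12,\frac12\}$, and $\int f(\gamma)\,d\gamma=\sum_{\sigma}\int_{\mathbb{R}^3}f(\mathbf{r},\sigma)\,d\mathbf{r}$. The inner product is $\langle f,g\rangle=\int f\,\overline{g}$ (over $\gamma$, or over $\gamma_1,\dots,\gamma_N$ for $N$-particle functions). $\mathcal{T}+\mathcal{V}=\sum_{i=1}^N\left(-\frac12\Delta_i+v(\mathbf{r}_i)\right)$, where $\Delta_i$ is the Laplacian in $\mathbf{r}_i$ and $v(\mathbf{r})$ is a finite sum of terms $-Z_a/\|\mathbf{r}-\mathbf{R}_a\|$; the one-particle operator is $(\mathcal{T}_*+\mathcal{V}_* )[f](\gamma)=\left(-\frac12\Delta+v(\mathbf{r})\right)f(\mathbf{r},\sigma)$, applied entrywise to vectors of functions. $\phi_1,\dots,\phi_N$ and $\tilde\phi_1,\dots,\tilde\phi_N$ are complex-valued square-integrable functions of $\gamma$, regular enough that $(\mathcal{T}_*+\mathcal{V}_* )[\phi_i]$ is defined and all integrals written converge absolutely. $\mathbf{\Phi}=[\phi_1,\dots,\phi_N]^T$, $\tilde{\mathbf{\Phi}}=[\tilde\phi_1,\dots,\tilde\phi_N]^T$ (including $\tilde\phi_1$), and $^*$ is conjugate transpose; functions under an integral in $\gamma'$ with no variable shown are evaluated at $\gamma'$. $|\cdot|$ is the determinant. $\mathcal{A}$ is the antisymmetrizer, $(\mathcal{A}F)(\gamma_1,\dots,\gamma_N)=\frac1{N!}\sum_{\pi\in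 S_N}\mathrm{sgn}(\pi)F(\gamma_{\pi(1)},\dots,\gamma_{\pi(N)})$, and $\langle F,G\rangle_{\mathcal{A}}=\langle\mathcal{A}F,\mathcal{A}G\rangle=\langle F,\mathcal{A}G\rangle$. The delta function $\delta(\gamma-\gamma_1)$ (Dirac in $\mathbf{r}$, Kronecker in $\sigma$) in the first slot means evaluation at $\gamma_1=\gamma$: $$\Big\langle\delta(\gamma-\gamma_1)\prod_{i=2}^N\tilde\phi_i(\gamma_i),G\Big\rangle_{\mathcal{A}}=\int\prod_{i=2}^N\tilde\phi_i(\gamma_i)\,\overline{(\mathcal{A}G)(\gamma,\gamma_2,\dots,\gamma_N)}\,d\gamma_2\cdots d\gamma_N .$$ $\mathbb{E}$ is the $N\times N$ matrix whose first row is $\mathbf{d}^*$ and whose row $i$, for $2\le i\le N$, is $[\langle\tilde\phi_i,\phi_1\rangle,\dots,\langle\tilde\phi_i,\phi_N\rangle]$, where $\mathbf{d}\in\mathbb{C}^N$ is chosen to be a unit vector such that $\mathbf{d}^*$ is orthogonal to the remaining rows of $\mathbb{E}$, i.e. $\sum_j\langle\tilde\phi_i,\phi_j\rangle d(j)=0$ for $2\le i\le N$. Cost model: the functions $\phi_i,\tilde\phi_i$ are given; representing, adding, scaling, multiplying pointwise or integrating one-particle functions, and applying $\mathcal{T}_*+\mathcal{V}_*$ to one of them, costs $\mathcal{O}(M)$ each, with $N\le M$; scalar operations cost $\mathcal{O}(1)$; inverse, determinant and singular value decomposition of an $N\times N$ matrix cost $\mathcal{O}(N^3)$. *)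

theory Defs
  imports
    "HOL-Analysis.Analysis"
    "HOL-Combinatorics.Permutations"
    "Jordan_Normal_Form.Determinant"
    "Jordan_Normal_Form.Gauss_Jordan_Elimination"
    "Jordan_Normal_Form.Schur_Decomposition"
begin

unbundle no vec_syntax

section \<open>Particles\<close>

text \<open>A particle variable is a pair of a position and a spin. Orbitals, particles and matrix
  entries are numbered from 0, so index 0 plays the role of the index 1 of the usual notation.\<close>

type_synonym particle = "(real ^ 3) \<times> real"
type_synonym orbital = "particle \<Rightarrow> complex"
type_synonym configuration = "nat \<Rightarrow> particle"

definition spins :: "real set" where
  "spins = {-1/2, 1/2}"

definition particle_borel :: "particle measure" where
  "particle_borel = lborel \<Otimes>\<^sub>M count_space spins"

text \<open>All integrals are Lebesgue integrals, hence taken with respect to a completed measure. This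
  matters: partial derivatives of a measurable function that exist almost everywhere need only be
  Lebesgue measurable, and \<open>integral\<^sup>L\<close> of a non-measurable function is 0.\<close>

definition particle_measure :: "particle measure" where
  "particle_measure = completion particle_borel"

text \<open>Integration over all particles but number 0.\<close>

definition rest_measure :: "nat \<Rightarrow> configuration measure" where
  "rest_measure N = completion (Pi\<^sub>M {1..<N} (\<lambda>_. particle_borel))"

definition orb_inner :: "orbital \<Rightarrow> orbital \<Rightarrow> complex" where
  "orb_inner f g = (\<integral>\<gamma>. f \<gamma> * cnj (g \<gamma>) \<partial>particle_measure)"

definition square_integrable :: "orbital \<Rightarrow> bool" where
  "square_integrable f \<longleftrightarrow> f \<in> borel_measurable particle_measure \<and>
     integrable particle_measure (\<lambda>\<gamma>. (cmod (f \<gamma>))\<^sup>2)"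

section \<open>Kinetic and nuclear potential energy\<close>

definition line_derivative :: "3 \<Rightarrow> (real ^ 3 \<Rightarrow> complex) \<Rightarrow> real ^ 3 \<Rightarrow> real \<Rightarrow> complex" where
  "line_derivative k f r s = vector_derivative (\<lambda>t. f (r + t *\<^sub>R axis k 1)) (at s)"

definition second_partial :: "3 \<Rightarrow> (real ^ 3 \<Rightarrow> complex) \<Rightarrow> real ^ 3 \<Rightarrow> complex" where
  "second_partial k f r = vector_derivative (line_derivative k f r) (at 0)"

definition twice_partially_differentiable ::
    "3 \<Rightarrow> (real ^ 3 \<Rightarrow> complex) \<Rightarrow> real ^ 3 \<Rightarrow> bool" where
  "twice_partially_differentiable k f r \<longleftrightarrow>
     (\<forall>\<^sub>F s in nhds 0. (\<lambda>t. f (r + t *\<^sub>R axis k 1)) differentiable (at s)) \<and>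
     line_derivative k f r differentiable (at 0)"

definition laplacian :: "(real ^ 3 \<Rightarrow> complex) \<Rightarrow> real ^ 3 \<Rightarrow> complex" where
  "laplacian f r = (\<Sum>k\<in>UNIV. second_partial k f r)"

text \<open>The nuclei are given as a list of pairs of a charge and a position.\<close>

type_synonym nuclei = "(real \<times> (real ^ 3)) list"

definition potential :: "nuclei \<Rightarrow> real ^ 3 \<Rightarrow> real" where
  "potential nuc r = (\<Sum>(Z, R)\<leftarrow>nuc. - Z / norm (r - R))"

definition one_op :: "nuclei \<Rightarrow> orbital \<Rightarrow> orbital" where
  "one_op nuc f = (\<lambda>(r, \<sigma>).
     - (1/2) * laplacian (\<lambda>x. f (x, \<sigma>)) r + complex_of_real (potential nuc r) * f (r, \<sigma>))"

text \<open>The points at which the expression defining \<^const>\<open>one_op\<close> makes sense.\<close>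

definition one_op_defined_at :: "nuclei \<Rightarrow> orbital \<Rightarrow> particle \<Rightarrow> bool" where
  "one_op_defined_at nuc f \<gamma> \<longleftrightarrow>
     (\<forall>(Z, R)\<in>set nuc. fst \<gamma> \<noteq> R) \<and>
     (\<forall>k. twice_partially_differentiable k (\<lambda>x. f (x, snd \<gamma>)) (fst \<gamma>))"

text \<open>Only definedness almost everywhere is required. This covers the domain \<open>H\<^sup>2\<close> of the
  operator: the continuous representative of such a function is, along almost every line parallel
  to an axis, continuously differentiable with absolutely continuous derivative, and its pointwise
  second partial derivatives agree almost everywhere with the weak ones.\<close>

definition one_op_defined :: "nuclei \<Rightarrow> orbital \<Rightarrow> bool" where
  "one_op_defined nuc f \<longleftrightarrow> (AE \<gamma> in particle_measure. one_op_defined_at nuc f \<gamma>)"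

definition many_op ::
    "nat \<Rightarrow> nuclei \<Rightarrow> (configuration \<Rightarrow> complex) \<Rightarrow> configuration \<Rightarrow> complex" where
  "many_op N nuc F \<xi> =
     (\<Sum>i<N. - (1/2) * laplacian (\<lambda>x. F (\<xi>(i := (x, snd (\<xi> i))))) (fst (\<xi> i))
            + complex_of_real (potential nuc (fst (\<xi> i))) * F \<xi>)"

section \<open>Antisymmetric inner product with a delta function\<close>

definition orb_product :: "nat \<Rightarrow> (nat \<Rightarrow> orbital) \<Rightarrow> configuration \<Rightarrow> complex" where
  "orb_product N \<phi> \<xi> = (\<Prod>i<N. \<phi> i (\<xi> i))"

definition antisymmetrizer ::
    "nat \<Rightarrow> (configuration \<Rightarrow> complex) \<Rightarrow> configuration \<Rightarrow> complex" where
  "antisymmetrizer N F \<xi> =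
     (\<Sum>\<pi> | \<pi> permutes {..<N}. of_int (sign \<pi>) * F (\<lambda>i. \<xi> (\<pi> i))) / fact N"

definition delta_inner_A ::
    "nat \<Rightarrow> (nat \<Rightarrow> orbital) \<Rightarrow> (configuration \<Rightarrow> complex) \<Rightarrow> particle \<Rightarrow> complex" where
  "delta_inner_A N \<phi>t G \<gamma> =
     (\<integral>\<xi>. (\<Prod>i=1..<N. \<phi>t i (\<xi> i)) * cnj (antisymmetrizer N G (\<xi>(0 := \<gamma>))) \<partial>rest_measure N)"

section \<open>The data\<close>

definition admissible :: "nat \<Rightarrow> nuclei \<Rightarrow> (nat \<Rightarrow> orbital) \<Rightarrow> (nat \<Rightarrow> orbital) \<Rightarrow> bool" where
  "admissible N nuc \<phi> \<phi>t \<longleftrightarrow>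
     (\<forall>i<N. square_integrable (\<phi> i) \<and> square_integrable (\<phi>t i) \<and> one_op_defined nuc (\<phi> i)) \<and>
     (\<forall>i<N. \<forall>j<N. integrable particle_measure (\<lambda>\<gamma>. \<phi>t i \<gamma> * cnj (one_op nuc (\<phi> j) \<gamma>)))"

definition E_matrix ::
    "nat \<Rightarrow> (nat \<Rightarrow> orbital) \<Rightarrow> (nat \<Rightarrow> orbital) \<Rightarrow> complex vec \<Rightarrow> complex mat" where
  "E_matrix N \<phi> \<phi>t d =
     mat N N (\<lambda>(i, j). if i = 0 then cnj (d $ j) else orb_inner (\<phi>t i) (\<phi> j))"

definition unit_null_vector ::
    "nat \<Rightarrow> (nat \<Rightarrow> orbital) \<Rightarrow> (nat \<Rightarrow> orbital) \<Rightarrow> complex vec \<Rightarrow> bool" where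
  "unit_null_vector N \<phi> \<phi>t d \<longleftrightarrow>
     d \<in> carrier_vec N \<and> (\<Sum>j<N. (cmod (d $ j))\<^sup>2) = 1 \<and>
     (\<forall>i\<in>{1..<N}. (\<Sum>j<N. orb_inner (\<phi>t i) (\<phi> j) * d $ j) = 0)"

definition Theta ::
    "nat \<Rightarrow> (nat \<Rightarrow> orbital) \<Rightarrow> (nat \<Rightarrow> orbital) \<Rightarrow> complex vec \<Rightarrow> nat \<Rightarrow> orbital" where
  "Theta N \<phi> \<phi>t d i \<gamma> = (\<Sum>j<N. the (mat_inverse (E_matrix N \<phi> \<phi>t d)) $$ (i, j) * \<phi>t j \<gamma>)"

section \<open>Cost model\<close>

text \<open>Algorithms are straight-line programs over a memory of scalars and of one-particle functions.
  Scalars have addresses \<open>(k, i, j)\<close>, read as entry \<open>(i, j)\<close> of a matrix number \<open>k\<close>; functions have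
  addresses \<open>(k, i)\<close>. The first address argument of an instruction is the destination, except that
  \<open>MSvd a u s v\<close> reads matrix \<open>a\<close> and writes matrices \<open>u\<close>, \<open>s\<close>, \<open>v\<close>. The only scalar constant is 1.\<close>

type_synonym saddr = "nat \<times> nat \<times> nat"
type_synonym faddr = "nat \<times> nat"

datatype instr =
    SOne saddr
  | SAdd saddr saddr saddr
  | SSub saddr saddr saddr
  | SMul saddr saddr saddr
  | SDiv saddr saddr saddr
  | SCnj saddr saddr
  | FAdd faddr faddr faddr
  | FScale faddr saddr faddr
  | FMul faddr faddr faddr
  | FCnj faddr faddr
  | FInt saddr faddr
  | FOp faddr faddr
  | MInv nat nat
  | MDet saddr nat
  | MSvd nat nat nat nat

text \<open>Unit constants suffice here: if every instruction costs at most \<open>K\<close> times the number below,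
  then so does every program.\<close>

fun instr_cost :: "nat \<Rightarrow> nat \<Rightarrow> instr \<Rightarrow> nat" where
  "instr_cost N M (FAdd _ _ _) = M"
| "instr_cost N M (FScale _ _ _) = M"
| "instr_cost N M (FMul _ _ _) = M"
| "instr_cost N M (FCnj _ _) = M"
| "instr_cost N M (FInt _ _) = M"
| "instr_cost N M (FOp _ _) = M"
| "instr_cost N M (MInv _ _) = N ^ 3"
| "instr_cost N M (MDet _ _) = N ^ 3"
| "instr_cost N M (MSvd _ _ _ _) = N ^ 3"
| "instr_cost N M _ = 1"

definition program_cost :: "nat \<Rightarrow> nat \<Rightarrow> instr list \<Rightarrow> nat" where
  "program_cost N M P = sum_list (map (instr_cost N M) P)"

record memory =
  scal :: "saddr \<Rightarrow> complex"
  func :: "faddr \<Rightarrow> orbital"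

definition read_mat :: "nat \<Rightarrow> nat \<Rightarrow> memory \<Rightarrow> complex mat" where
  "read_mat N k m = mat N N (\<lambda>(i, j). scal m (k, i, j))"

definition write_scal :: "saddr \<Rightarrow> complex \<Rightarrow> memory \<Rightarrow> memory" where
  "write_scal a c m = m\<lparr>scal := (scal m)(a := c)\<rparr>"

definition write_func :: "faddr \<Rightarrow> orbital \<Rightarrow> memory \<Rightarrow> memory" where
  "write_func b f m = m\<lparr>func := (func m)(b := f)\<rparr>"

definition write_mat :: "nat \<Rightarrow> nat \<Rightarrow> complex mat \<Rightarrow> memory \<Rightarrow> memory" where
  "write_mat N k A m =
     m\<lparr>scal := \<lambda>(l, i, j). if l = k \<and> i < N \<and> j < N then A $$ (i, j) else scal m (l, i, j)\<rparr>"

text \<open>A singular value decomposition \<open>A = U S V\<^sup>*\<close> with singular values in descending order. It is not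
  unique, so programs are run relative to an arbitrary routine that returns one.\<close>

definition is_svd :: "nat \<Rightarrow> complex mat \<Rightarrow> complex mat \<times> complex mat \<times> complex mat \<Rightarrow> bool" where
  "is_svd N A = (\<lambda>(U, S, V).
     U \<in> carrier_mat N N \<and> S \<in> carrier_mat N N \<and> V \<in> carrier_mat N N \<and>
     inverts_mat U (mat_adjoint U) \<and> inverts_mat (mat_adjoint U) U \<and>
     inverts_mat V (mat_adjoint V) \<and> inverts_mat (mat_adjoint V) V \<and>
     diagonal_mat S \<and>
     (\<forall>i<N. S $$ (i, i) \<in> \<real> \<and> 0 \<le> Re (S $$ (i, i))) \<and>
     (\<forall>i j. i \<le> j \<longrightarrow> j < N \<longrightarrow> Re (S $$ (j, j)) \<le> Re (S $$ (i, i))) \<and>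
     A = U * S * mat_adjoint V)"

type_synonym svd_routine = "complex mat \<Rightarrow> complex mat \<times> complex mat \<times> complex mat"

definition svd_correct :: "nat \<Rightarrow> svd_routine \<Rightarrow> bool" where
  "svd_correct N svd \<longleftrightarrow> (\<forall>A\<in>carrier_mat N N. is_svd N A (svd A))"

text \<open>The result is \<^const>\<open>None\<close> if the operation is undefined on its operands (division by zero,
  divergent integral, ...), so that no program can exploit the default values of total functions.\<close>

fun step :: "svd_routine \<Rightarrow> nuclei \<Rightarrow> nat \<Rightarrow> instr \<Rightarrow> memory \<Rightarrow> memory option" where
  "step svd nuc N (SOne c) m = Some (write_scal c 1 m)"
| "step svd nuc N (SAdd c a b) m = Some (write_scal c (scal m a + scal m b) m)"
| "step svd nuc N (SSub c a b) m = Some (write_scal c (scal m a - scal m b) m)"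
| "step svd nuc N (SMul c a b) m = Some (write_scal c (scal m a * scal m b) m)"
| "step svd nuc N (SDiv c a b) m =
     (if scal m b \<noteq> 0 then Some (write_scal c (scal m a / scal m b) m) else None)"
| "step svd nuc N (SCnj c a) m = Some (write_scal c (cnj (scal m a)) m)"
| "step svd nuc N (FAdd h f g) m = Some (write_func h (\<lambda>\<gamma>. func m f \<gamma> + func m g \<gamma>) m)"
| "step svd nuc N (FScale h a f) m = Some (write_func h (\<lambda>\<gamma>. scal m a * func m f \<gamma>) m)"
| "step svd nuc N (FMul h f g) m = Some (write_func h (\<lambda>\<gamma>. func m f \<gamma> * func m g \<gamma>) m)"
| "step svd nuc N (FCnj h f) m = Some (write_func h (\<lambda>\<gamma>. cnj (func m f \<gamma>)) m)"
| "step svd nuc N (FInt c f) m =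
     (if integrable particle_measure (func m f)
      then Some (write_scal c (\<integral>\<gamma>. func m f \<gamma> \<partial>particle_measure) m) else None)"
| "step svd nuc N (FOp h f) m =
     (if one_op_defined nuc (func m f)
      then Some (write_func h (one_op nuc (func m f)) m) else None)"
| "step svd nuc N (MInv l k) m =
     (case mat_inverse (read_mat N k m) of
        None \<Rightarrow> None
      | Some B \<Rightarrow> Some (write_mat N l B m))"
| "step svd nuc N (MDet c k) m = Some (write_scal c (Determinant.det (read_mat N k m)) m)"
| "step svd nuc N (MSvd a u s v) m =
     (case svd (read_mat N a m) of
        (U, S, V) \<Rightarrow> Some (write_mat N v V (write_mat N s S (write_mat N u U m))))"

primrec run :: "svd_routine \<Rightarrow> nuclei \<Rightarrow> nat \<Rightarrow> instr list \<Rightarrow> memory \<Rightarrow> memory option" where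
  "run svd nuc N [] m = Some m"
| "run svd nuc N (c # P) m = Option.bind (step svd nuc N c m) (run svd nuc N P)"

text \<open>The given functions are stored at the addresses \<open>(0, i)\<close> and \<open>(1, i)\<close>.\<close>

definition input_memory :: "nat \<Rightarrow> (nat \<Rightarrow> orbital) \<Rightarrow> (nat \<Rightarrow> orbital) \<Rightarrow> memory" where
  "input_memory N \<phi> \<phi>t =
     \<lparr>scal = (\<lambda>_. 0),
      func = (\<lambda>(k, i). if k = 0 \<and> i < N then \<phi> i else if k = 1 \<and> i < N then \<phi>t i else (\<lambda>_. 0))\<rparr>"

end

theory Submission
  imports Defs
begin

text \<open>Expanding the antisymmetrizer and integrating out \<open>\<gamma>\<^sub>2, \<dots>, \<gamma>\<^sub>N\<close> gives \<open>1/N!\<close> times the sum over \<open>k\<close>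
  of the determinants of \<open>M\<close> with column \<open>k\<close> replaced by that of \<open>H\<close>, where \<open>M\<close> and \<open>H\<close> have first rows
  \<open>\<Phi>(\<gamma>)\<^sup>*\<close> and \<open>h \<Phi>(\<gamma>)\<^sup>*\<close>, with \<open>h\<close> the one-particle operator, and inner products in the other rows. Below
  the first row, \<open>M\<close> agrees with the matrix \<open>E\<close>, and \<open>E d\<close> is the first unit vector. Expanding along the
  first row, the cofactor of entry \<open>j\<close> is the determinant of \<open>E\<close> with column \<open>k\<close> replaced by \<open>E q\<close> and
  column \<open>j\<close> by \<open>E d\<close>, where \<open>E q\<close> is column \<open>k\<close> of \<open>H\<close>, that is, \<open>|E| (q\<^sub>k d\<^sub>j - q\<^sub>j d\<^sub>k)\<close>.

  For the cost bound, a singular value decomposition of the overlap matrix with first row 0 yields a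
  suitable \<open>d\<close>; everything else is \<open>O(N\<^sup>2)\<close> integrals and a few matrix operations.\<close>

section \<open>Determinants with replaced columns\<close>

text \<open>The matrix is the identity with columns \<open>j\<close> and \<open>k\<close> replaced
  by \<open>d\<close> and \<open>q\<close>. A permutation contributing to the Leibniz sum must fix
  every index outside \<open>{j, k}\<close>, so only \<open>id\<close> and the transposition
  survive; they give the two products.\<close>

lemma det_replace_two_cols_one:
  fixes q d :: "nat \<Rightarrow> 'a :: comm_ring_1"
  assumes j: "j < n" and k: "k < n" and "j \<noteq> k"
  shows "Determinant.det (mat n n (\<lambda>(i, l). if l = j then d i else if l = k then q i else if i = l then 1 else 0))
    = q k * d j - q j * d k"
proof -
  let ?A = "mat n n (\<lambda>(i, l). if l = j then d i else if l = k then q i else if i = l then 1 else 0)"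
  let ?U = "{0..<n}"
  let ?g = "\<lambda>p. signof p * (\<Prod>i\<in>?U. ?A $$ (i, p i))"
  let ?t = "Transposition.transpose j k"
  have t: "?t permutes ?U" using j k by (simp add: permutes_swap_id)
  have "Determinant.det ?A = (\<Sum>p | p permutes ?U. ?g p)"
    by (rule det_def') simp
  also have "\<dots> = (\<Sum>p\<in>{id, ?t}. ?g p)"
  proof (rule sum.mono_neutral_right)
    show "finite {p. p permutes ?U}" by (simp add: finite_permutations)
    show "{id, ?t} \<subseteq> {p. p permutes ?U}" using t permutes_id by auto
    show "\<forall>p\<in>{p. p permutes ?U} - {id, ?t}. ?g p = 0"
    proof
      fix p assume p: "p \<in> {p. p permutes ?U} - {id, ?t}"
      then have pp: "p permutes ?U" by auto
      have "\<exists>i\<in>?U. ?A $$ (i, p i) = 0"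
      proof (rule ccontr)
        assume "\<not> ?thesis"
        then have nz: "\<And>i. i < n \<Longrightarrow> ?A $$ (i, p i) \<noteq> 0" by auto
        have pn: "\<And>i. i < n \<Longrightarrow> p i < n" using pp permutes_in_image by fastforce
        have fix_i: "p i \<in> {j, k} \<or> p i = i" if "i < n" for i
          using nz[OF that] pn[OF that] that by (auto split: if_splits)
        \<comment> \<open>Pigeonhole: if \<open>p\<close> moved \<open>i\<close>, then
          \<open>p i\<close>, \<open>p j\<close> and \<open>p k\<close> would be three distinct
          elements of \<open>{j, k}\<close>.\<close>
        have off: "p i = i" if "i \<notin> {j, k}" for i
        proof (cases "i < n")
          case True
          show ?thesis
          proof (rule ccontr)
            assume ne: "p i \<noteq> i"
            have inj: "inj p" using pp permutes_inj by blast
            have pi: "p i \<in> {j, k}" using fix_i[OF True] ne by blast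
            have "p j \<in> {j, k}" "p k \<in> {j, k}" using fix_i j k by auto
            moreover have "p j \<noteq> p k" "p i \<noteq> p j" "p i \<noteq> p k"
              using inj \<open>j \<noteq> k\<close> that by (auto simp: inj_eq)
            ultimately show False using pi by auto
          qed
        qed (use pp in \<open>auto simp: permutes_def\<close>)
        have pj: "p permutes {j, k}"
          using pp off unfolding permutes_def by blast
        show False using p pj \<open>j \<noteq> k\<close> by (auto simp: permutes_doubleton_iff)
      qed
      then have "(\<Prod>i\<in>?U. ?A $$ (i, p i)) = 0" by (meson finite_atLeastLessThan prod_zero)
      then show "?g p = 0" by simp
    qed
  qed
  also have "\<dots> = ?g id + ?g ?t"
  proof -
    have "id \<noteq> ?t" using \<open>j \<noteq> k\<close> by (metis id_apply transpose_apply_first)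
    then show ?thesis by simp
  qed
  also have "?g id = q k * d j"
  proof -
    have "(\<Prod>i\<in>?U. ?A $$ (i, id i)) = (\<Prod>i\<in>?U. if i = j then d j else if i = k then q k else 1)"
      by (rule prod.cong) (use j k in auto)
    also have "\<dots> = d j * (\<Prod>i\<in>?U - {j}. if i = k then q k else 1)"
      using j by (subst prod.remove[of _ j]) (auto intro!: prod.cong)
    also have "\<dots> = d j * q k"
      using k \<open>j \<noteq> k\<close> by simp
    finally show ?thesis by (simp add: sign_id)
  qed
  also have "?g ?t = - (q j * d k)"
  proof -
    have "(\<Prod>i\<in>?U. ?A $$ (i, ?t i)) = (\<Prod>i\<in>?U. if i = j then q j else if i = k then d k else 1)"
      by (rule prod.cong) (use j k \<open>j \<noteq> k\<close> in \<open>auto simp: transpose_def\<close>)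
    also have "\<dots> = q j * (\<Prod>i\<in>?U - {j}. if i = k then d k else 1)"
      using j by (subst prod.remove[of _ j]) (auto intro!: prod.cong)
    also have "\<dots> = q j * d k"
      using k \<open>j \<noteq> k\<close> by simp
    finally show ?thesis using \<open>j \<noteq> k\<close> by (simp add: sign_swap_id)
  qed
  finally show ?thesis by simp
qed

text \<open>Expansion along column \<open>j\<close> leaves a single term, whose minor does not see
  that column. Cofactors thus become full-size determinants, to which multiplicativity
  applies.\<close>

lemma det_replace_col_unit_vec:
  assumes A: "A \<in> carrier_mat n n" and i: "i < n" and j: "j < n"
  shows "Determinant.det (replace_col A (unit_vec n i) j) = cofactor A i j"
proof -
  let ?B = "replace_col A (unit_vec n i) j"
  have B: "?B \<in> carrier_mat n n" using A by (simp add: replace_col_def)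
  have "Determinant.det ?B = (\<Sum>l<n. ?B $$ (l, j) * cofactor ?B l j)"
    by (rule laplace_expansion_column[OF B j])
  also have "\<dots> = (\<Sum>l<n. if l = i then cofactor ?B i j else 0)"
    using A i j by (intro sum.cong) (auto simp: replace_col_def[of A])
  also have "\<dots> = cofactor ?B i j" using i by simp
  also have "mat_delete ?B i j = mat_delete A i j"
    using A i j by (intro eq_matI) (auto simp: mat_delete_def replace_col_def)
  then have "cofactor ?B i j = cofactor A i j" by (simp add: cofactor_def)
  finally show ?thesis .
qed

lemma cofactor_cong_row:
  assumes "A \<in> carrier_mat n n" "B \<in> carrier_mat n n" "i < n" "j < n"
    and "\<And>i' j'. i' < n \<Longrightarrow> j' < n \<Longrightarrow> i' \<noteq> i \<Longrightarrow> A $$ (i', j') = B $$ (i', j')"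
  shows "cofactor A i j = cofactor B i j"
proof -
  have "mat_delete A i j = mat_delete B i j"
    using assms by (intro eq_matI) (auto simp: mat_delete_def)
  then show ?thesis by (simp add: cofactor_def)
qed

text \<open>By the previous lemma the cofactor is the determinant of \<open>E\<close> with column
  \<open>k\<close> replaced by \<open>E q\<close> and column \<open>j\<close> by the unit vector,
  which is \<open>E d\<close>. For \<open>j \<noteq> k\<close> this matrix is \<open>E\<close> times
  the identity with columns \<open>k\<close> and \<open>j\<close> replaced by \<open>q\<close> and
  \<open>d\<close>, and determinants multiply. For \<open>j = k\<close> the second replacement
  overwrites the first, and Cramer's rule remains.\<close>

lemma cofactor_replace_col:
  fixes E :: "'a :: comm_ring_1 mat"
  assumes E: "E \<in> carrier_mat n n" and q: "q \<in> carrier_vec n" and d: "d \<in> carrier_vec n"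
    and Ed: "E *\<^sub>v d = unit_vec n i"
    and i: "i < n" and j: "j < n" and k: "k < n"
  shows "cofactor (replace_col E (E *\<^sub>v q) k) i j =
    Determinant.det E * (if j = k then d $ k else q $ k * d $ j - q $ j * d $ k)"
proof -
  let ?F = "replace_col E (E *\<^sub>v q) k"
  have F: "?F \<in> carrier_mat n n" using E by (simp add: replace_col_def)
  have *: "cofactor ?F i j = Determinant.det (replace_col ?F (unit_vec n i) j)"
    by (rule det_replace_col_unit_vec[OF F i j, symmetric])
  show ?thesis
  proof (cases "j = k")
    case True
    have "replace_col ?F (unit_vec n i) j = replace_col E (E *\<^sub>v d) k"
      using E True Ed by (intro eq_matI) (auto simp: replace_col_def)
    then show ?thesis using * True cramer_lemma_mat[OF E d k] by simp
  next
    case False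
    let ?Y = "mat n n (\<lambda>(i, l). if l = j then d $ i else if l = k then q $ i else if i = l then 1 else 0)"
    have "replace_col ?F (unit_vec n i) j = E * ?Y"
    proof (rule eq_matI)
      fix a b assume "a < dim_row (E * ?Y)" "b < dim_col (E * ?Y)"
      then have a: "a < n" and b: "b < n" using E by auto
      have "(E * ?Y) $$ (a, b) = row E a \<bullet> col ?Y b" using E a b by simp
      also have "col ?Y b = (if b = j then d else if b = k then q else unit_vec n b)"
        using q d b by (auto simp: unit_vec_def)
      also have "row E a \<bullet> \<dots> = replace_col ?F (unit_vec n i) j $$ (a, b)"
        using E a b q d Ed[symmetric] by (auto simp: replace_col_def row_def)
      finally show "replace_col ?F (unit_vec n i) j $$ (a, b) = (E * ?Y) $$ (a, b)" by simp
    qed (use E in \<open>auto simp: replace_col_def\<close>)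
    then have "Determinant.det (replace_col ?F (unit_vec n i) j) = Determinant.det E * Determinant.det ?Y"
      using E by (simp add: det_mult[of _ n])
    moreover have "Determinant.det ?Y = q $ k * d $ j - q $ j * d $ k"
      by (rule det_replace_two_cols_one[OF j k False])
    ultimately show ?thesis using * False by simp
  qed
qed

text \<open>Row \<open>i\<close> of \<open>K\<close> is arbitrary: its contributions to the trace and to the matrix-vector product cancel.\<close>

lemma sum_det_replace_col:
  fixes E :: "'a :: comm_ring_1 mat"
  assumes E: "E \<in> carrier_mat n n" and B: "B \<in> carrier_mat n n" and inv: "E * B = 1\<^sub>m n"
    and M: "M \<in> carrier_mat n n" and H: "H \<in> carrier_mat n n" and K: "K \<in> carrier_mat n n"
    and d: "d \<in> carrier_vec n" and Ed: "E *\<^sub>v d = unit_vec n i" and i: "i < n"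
    and ME: "\<And>i' j. i' < n \<Longrightarrow> j < n \<Longrightarrow> i' \<noteq> i \<Longrightarrow> M $$ (i', j) = E $$ (i', j)"
    and HK: "\<And>i' j. i' < n \<Longrightarrow> j < n \<Longrightarrow> i' \<noteq> i \<Longrightarrow> H $$ (i', j) = K $$ (i', j)"
  shows "(\<Sum>k<n. Determinant.det (replace_col M (col H k) k)) =
    Determinant.det E *
      ((\<Sum>j<n. M $$ (i, j) * (d $ j * (\<Sum>k<n. (B * K) $$ (k, k)) - (\<Sum>k<n. (B * K) $$ (j, k) * d $ k)))
       + (\<Sum>k<n. H $$ (i, k) * d $ k))"
proof -
  define Q where "Q = B * K"
  have Q: "Q \<in> carrier_mat n n" using B K by (simp add: Q_def)
  have EQ: "E * Q = K"
    using assoc_mult_mat[OF E B K] inv K by (simp add: Q_def)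
  have one: "Determinant.det (replace_col M (col H k) k) =
      Determinant.det E * ((\<Sum>j<n. M $$ (i, j) * (d $ j * Q $$ (k, k) - Q $$ (j, k) * d $ k))
        + H $$ (i, k) * d $ k)" if k: "k < n" for k
  proof -
    let ?W = "replace_col M (col H k) k"
    let ?F = "replace_col E (E *\<^sub>v col Q k) k"
    have W: "?W \<in> carrier_mat n n" using M by (simp add: replace_col_def)
    have F: "?F \<in> carrier_mat n n" using E by (simp add: replace_col_def)
    have EQk: "E *\<^sub>v col Q k = col K k"
      using E Q k EQ by (metis col_mult2)
    \<comment> \<open>Cofactors along row \<open>i\<close> ignore that row, and off it
      \<open>M\<close> agrees with \<open>E\<close> and \<open>H\<close> with
      \<open>K = E * Q\<close>.\<close>
    have cof: "cofactor ?W i j = cofactor ?F i j" if j: "j < n" for j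
    proof (rule cofactor_cong_row[OF W F i j])
      fix a b assume "a < n" "b < n" "a \<noteq> i"
      then show "?W $$ (a, b) = ?F $$ (a, b)"
        unfolding EQk using E M H K k ME HK by (auto simp: replace_col_def)
    qed
    have "Determinant.det ?W = (\<Sum>j<n. ?W $$ (i, j) * cofactor ?W i j)"
      by (rule laplace_expansion_row[OF W i])
    also have "\<dots> = (\<Sum>j<n. (if j = k then H $$ (i, k) else M $$ (i, j)) *
        (Determinant.det E * (if j = k then d $ k else Q $$ (k, k) * d $ j - Q $$ (j, k) * d $ k)))"
    proof (intro sum.cong refl)
      fix j assume "j \<in> {..<n}"
      then have j: "j < n" by simp
      have "?W $$ (i, j) = (if j = k then H $$ (i, k) else M $$ (i, j))"
        using i j k M H by (simp add: replace_col_def)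
      moreover have "col Q k $ k = Q $$ (k, k)" "col Q k $ j = Q $$ (j, k)" "col Q k \<in> carrier_vec n"
        using Q j k by auto
      ultimately show "?W $$ (i, j) * cofactor ?W i j = (if j = k then H $$ (i, k) else M $$ (i, j)) *
        (Determinant.det E * (if j = k then d $ k else Q $$ (k, k) * d $ j - Q $$ (j, k) * d $ k))"
        by (simp add: cof[OF j] cofactor_replace_col[OF E _ d Ed i j k])
    qed
    \<comment> \<open>The bracket \<open>d $ j * Q $$ (k, k) - Q $$ (j, k) * d $ k\<close> vanishes
      at \<open>j = k\<close>, so the first part may run over all \<open>j\<close>, and the
      \<open>H\<close> entry is split off as a separate term.\<close>
    also have "\<dots> = (\<Sum>j<n. Determinant.det E * (M $$ (i, j) * (d $ j * Q $$ (k, k) - Q $$ (j, k) * d $ k))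
        + (if j = k then Determinant.det E * (H $$ (i, k) * d $ k) else 0))"
      by (intro sum.cong) (auto simp: algebra_simps)
    also have "\<dots> = Determinant.det E * ((\<Sum>j<n. M $$ (i, j) * (d $ j * Q $$ (k, k) - Q $$ (j, k) * d $ k))
        + H $$ (i, k) * d $ k)"
      using k by (simp add: sum.distrib sum_distrib_left[symmetric] distrib_left)
    finally show ?thesis .
  qed
  have "(\<Sum>k<n. Determinant.det (replace_col M (col H k) k)) =
      Determinant.det E * ((\<Sum>k<n. \<Sum>j<n. M $$ (i, j) * (d $ j * Q $$ (k, k) - Q $$ (j, k) * d $ k))
        + (\<Sum>k<n. H $$ (i, k) * d $ k))"
    by (simp add: one sum.distrib sum_distrib_left[symmetric])
  also have "(\<Sum>k<n. \<Sum>j<n. M $$ (i, j) * (d $ j * Q $$ (k, k) - Q $$ (j, k) * d $ k)) =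
      (\<Sum>j<n. M $$ (i, j) * (d $ j * (\<Sum>k<n. Q $$ (k, k)) - (\<Sum>k<n. Q $$ (j, k) * d $ k)))"
    by (subst sum.swap) (simp add: sum_distrib_left sum_subtractf right_diff_distrib)
  finally show ?thesis by (simp add: Q_def)
qed

section \<open>The one-particle operator\<close>

text \<open>Derivatives in a real variable commute with real-linear maps. Real linearity is the
  right generality because complex conjugation has to be covered along with multiplication by
  constants.\<close>

lemma second_partial_sum_bounded_linear:
  assumes L: "\<And>i. i \<in> I \<Longrightarrow> bounded_linear (L i)"
    and "finite I"
    and diff: "\<And>i. i \<in> I \<Longrightarrow> twice_partially_differentiable k (f i) r"
  shows "second_partial k (\<lambda>x. \<Sum>i\<in>I. L i (f i x)) r = (\<Sum>i\<in>I. L i (second_partial k (f i) r))"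
proof -
  let ?F = "\<lambda>x. \<Sum>i\<in>I. L i (f i x)"
  let ?D = "\<lambda>s. \<Sum>i\<in>I. L i (line_derivative k (f i) r s)"
  \<comment> \<open>The first derivatives exist only near 0, on a common neighbourhood since
    \<open>I\<close> is finite. This suffices, as the second derivative at 0 depends only on the
    germ there.\<close>
  have 1: "\<forall>\<^sub>F s in nhds 0. line_derivative k ?F r s = ?D s"
  proof -
    have "\<forall>\<^sub>F s in nhds 0. \<forall>i\<in>I. (\<lambda>t. f i (r + t *\<^sub>R axis k 1)) differentiable (at s)"
      using diff \<open>finite I\<close> by (intro eventually_ball_finite) (auto simp: twice_partially_differentiable_def)
    then show ?thesis
    proof eventually_elim
      case (elim s)
      have "((\<lambda>t. L i (f i (r + t *\<^sub>R axis k 1))) has_vector_derivative L i (line_derivative k (f i) r s)) (at s)"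
        if "i \<in> I" for i
        unfolding line_derivative_def
        by (rule bounded_linear.has_vector_derivative[OF L[OF that]])
          (use elim that in \<open>simp add: vector_derivative_works\<close>)
      then have "((\<lambda>t. ?F (r + t *\<^sub>R axis k 1)) has_vector_derivative ?D s) (at s)"
        by (rule has_vector_derivative_sum)
      then show ?case unfolding line_derivative_def by (rule vector_derivative_at)
    qed
  qed
  have "((\<lambda>s. L i (line_derivative k (f i) r s)) has_vector_derivative L i (second_partial k (f i) r)) (at 0)"
    if "i \<in> I" for i
    unfolding second_partial_def
    by (rule bounded_linear.has_vector_derivative[OF L[OF that]])
      (use diff[OF that] in \<open>simp add: twice_partially_differentiable_def vector_derivative_works\<close>)
  then have "(?D has_vector_derivative (\<Sum>i\<in>I. L i (second_partial k (f i) r))) (at 0)"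
    by (rule has_vector_derivative_sum)
  moreover have "\<forall>\<^sub>F s in nhds 0. s \<in> UNIV \<longrightarrow> line_derivative k ?F r s = ?D s"
    using 1 by simp
  ultimately have "(line_derivative k ?F r has_vector_derivative (\<Sum>i\<in>I. L i (second_partial k (f i) r))) (at 0)"
    using eventually_nhds_x_imp_x[OF 1] by (subst has_vector_derivative_cong_ev)
  then show ?thesis unfolding second_partial_def by (rule vector_derivative_at)
qed

lemma laplacian_sum_bounded_linear:
  assumes "\<And>i. i \<in> I \<Longrightarrow> bounded_linear (L i)" "finite I"
    and "\<And>i k. i \<in> I \<Longrightarrow> twice_partially_differentiable k (f i) r"
  shows "laplacian (\<lambda>x. \<Sum>i\<in>I. L i (f i x)) r = (\<Sum>i\<in>I. L i (laplacian (f i) r))"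
proof -
  have "laplacian (\<lambda>x. \<Sum>i\<in>I. L i (f i x)) r = (\<Sum>k\<in>UNIV. \<Sum>i\<in>I. L i (second_partial k (f i) r))"
    unfolding laplacian_def by (intro sum.cong refl second_partial_sum_bounded_linear) (use assms in auto)
  also have "\<dots> = (\<Sum>i\<in>I. \<Sum>k\<in>UNIV. L i (second_partial k (f i) r))" by (rule sum.swap)
  also have "\<dots> = (\<Sum>i\<in>I. L i (laplacian (f i) r))"
    unfolding laplacian_def
    by (intro sum.cong refl linear_sum[symmetric] bounded_linear.linear assms(1))
  finally show ?thesis .
qed

lemma laplacian_mult_right:
  assumes "\<And>k. twice_partially_differentiable k f r"
  shows "laplacian (\<lambda>x. f x * c) r = laplacian f r * c"
  using laplacian_sum_bounded_linear[of "{()}" "\<lambda>_ z. z * c" "\<lambda>_. f"] assms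
  by (simp add: bounded_linear_mult_left)

text \<open>The potential is real and conjugation is real-linear, so the operator commutes with
  conjugation as well as with linear combinations. The identity is pointwise, hence the definedness
  assumption at the given particle.\<close>

lemma one_op_conj_combination:
  fixes N :: nat
  assumes "\<And>k. k < N \<Longrightarrow> one_op_defined_at nuc (\<phi> k) \<gamma>"
  shows "one_op nuc (\<lambda>\<gamma>'. \<Sum>k<N. cnj (\<phi> k \<gamma>') * c k) \<gamma> = (\<Sum>k<N. cnj (one_op nuc (\<phi> k) \<gamma>) * c k)"
proof -
  obtain r \<sigma> where \<gamma>: "\<gamma> = (r, \<sigma>)" by force
  have "laplacian (\<lambda>x. \<Sum>k<N. cnj (\<phi> k (x, \<sigma>)) * c k) r = (\<Sum>k<N. cnj (laplacian (\<lambda>x. \<phi> k (x, \<sigma>)) r) * c k)"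
  proof (rule laplacian_sum_bounded_linear)
    show "bounded_linear (\<lambda>z. cnj z * c k)" for k
      by (rule bounded_linear_compose[OF bounded_linear_mult_left bounded_linear_cnj])
    show "twice_partially_differentiable j (\<lambda>x. \<phi> k (x, \<sigma>)) r" if "k \<in> {..<N}" for j k
      using assms[of k] that by (simp add: one_op_defined_at_def \<gamma>)
  qed simp
  then show ?thesis
    by (simp add: one_op_def \<gamma> sum_distrib_left sum_subtractf sum_divide_distrib left_diff_distrib mult.assoc)
qed

text \<open>The Laplacian in particle \<open>k\<close> treats the other factors as constants, so the
  \<open>k\<close>-th summand of the Hamiltonian acts on the \<open>k\<close>-th orbital
  alone.\<close>

lemma many_op_orb_product:
  assumes "\<And>i. i < N \<Longrightarrow> one_op_defined_at nuc (\<phi> i) (\<xi> i)"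
  shows "many_op N nuc (orb_product N \<phi>) \<xi> =
    (\<Sum>k<N. \<Prod>i<N. (if i = k then one_op nuc (\<phi> k) else \<phi> i) (\<xi> i))"
  unfolding many_op_def
proof (intro sum.cong refl)
  fix k assume "k \<in> {..<N}"
  then have k: "k < N" by simp
  let ?c = "\<Prod>i\<in>{..<N} - {k}. \<phi> i (\<xi> i)"
  have prod_k: "(\<Prod>i<N. h i) = h k * (\<Prod>i\<in>{..<N} - {k}. h i)" for h :: "nat \<Rightarrow> complex"
    using k by (simp add: prod.remove)
  have upd: "orb_product N \<phi> (\<xi>(k := (x, snd (\<xi> k)))) = \<phi> k (x, snd (\<xi> k)) * ?c" for x
    unfolding orb_product_def prod_k by (auto intro!: arg_cong2[where f = "(*)"] prod.cong)
  have "laplacian (\<lambda>x. \<phi> k (x, snd (\<xi> k)) * ?c) (fst (\<xi> k)) =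
      laplacian (\<lambda>x. \<phi> k (x, snd (\<xi> k))) (fst (\<xi> k)) * ?c"
    using assms[OF k] by (intro laplacian_mult_right) (auto simp: one_op_defined_at_def)
  moreover have "(\<Prod>i<N. (if i = k then one_op nuc (\<phi> k) else \<phi> i) (\<xi> i)) = one_op nuc (\<phi> k) (\<xi> k) * ?c"
    unfolding prod_k by (auto intro!: arg_cong2[where f = "(*)"] prod.cong)
  moreover have "orb_product N \<phi> \<xi> = \<phi> k (\<xi> k) * ?c" by (simp add: orb_product_def prod_k)
  ultimately show "- (1/2) * laplacian (\<lambda>x. orb_product N \<phi> (\<xi>(k := (x, snd (\<xi> k))))) (fst (\<xi> k))
      + complex_of_real (potential nuc (fst (\<xi> k))) * orb_product N \<phi> \<xi> =
      (\<Prod>i<N. (if i = k then one_op nuc (\<phi> k) else \<phi> i) (\<xi> i))"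
    unfolding upd by (simp add: one_op_def case_prod_unfold algebra_simps)
qed

section \<open>Products of completed measures\<close>

text \<open>Follows from the real-valued case, applied to the real and the imaginary part.\<close>

lemma completion_ex_borel_measurable_complex:
  fixes f :: "'a \<Rightarrow> complex"
  assumes f: "f \<in> borel_measurable (completion M)"
  shows "\<exists>g\<in>borel_measurable M. AE x in M. f x = g x"
proof -
  have "(\<lambda>x. Re (f x)) \<in> borel_measurable (completion M)" "(\<lambda>x. Im (f x)) \<in> borel_measurable (completion M)"
    using f by auto
  from this[THEN completion_ex_borel_measurable_real] obtain a b
    where [measurable]: "a \<in> borel_measurable M" "b \<in> borel_measurable M"
      and "AE x in M. Re (f x) = a x" "AE x in M. Im (f x) = b x"
    by blast
  then have "AE x in M. f x = Complex (a x) (b x)"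
    by (auto simp: complex_eq_iff)
  moreover have "(\<lambda>x. Complex (a x) (b x)) \<in> borel_measurable M"
    by (simp add: borel_measurable_complex_iff)
  ultimately show ?thesis by (rule bexI)
qed

text \<open>In a complete measure, changing a function on a null set preserves measurability. This
  supplies the measurability of integrands containing pointwise derivatives, which
  \<open>integral_cong_AE\<close> demands on both sides.\<close>

lemma borel_measurable_completion_cong_AE:
  fixes f g :: "'a \<Rightarrow> 'b :: topological_space"
  assumes g: "g \<in> borel_measurable (completion M)" and ae: "AE x in completion M. f x = g x"
  shows "f \<in> borel_measurable (completion M)"
proof (rule measurableI)
  fix A :: "'b set" assume "A \<in> sets borel"
  then have "{x \<in> space (completion M). g x \<in> A} \<in> sets (completion M)"
    using g by measurable
  then show "f -` A \<inter> space (completion M) \<in> sets (completion M)"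
  proof (rule completion.in_sets_AE[rotated])
    show "AE x in completion M.
      x \<in> {x \<in> space (completion M). g x \<in> A} \<longleftrightarrow> x \<in> f -` A \<inter> space (completion M)"
      using ae by eventually_elim auto
  qed auto
qed auto

text \<open>The points that fail in coordinate \<open>i\<close> lie in a cylinder over a null set.
  Finitely many such null sets are then combined.\<close>

lemma (in product_sigma_finite) AE_PiM_finite:
  assumes "finite I" and ae: "\<And>i. i \<in> I \<Longrightarrow> AE x in M i. P i x"
  shows "AE \<xi> in Pi\<^sub>M I M. \<forall>i\<in>I. P i (\<xi> i)"
proof -
  have "AE \<xi> in Pi\<^sub>M I M. P i (\<xi> i)" if i: "i \<in> I" for i
  proof -
    obtain S where S: "S \<in> sets (M i)" "emeasure (M i) S = 0" "{x \<in> space (M i). \<not> P i x} \<subseteq> S"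
      using AE_E[OF ae[OF i]] by metis
    define A where "A = (\<lambda>j. if j = i then S else space (M j))"
    have "emeasure (Pi\<^sub>M I M) (Pi\<^sub>E I A) = (\<Prod>j\<in>I. emeasure (M j) (A j))"
      using S by (intro emeasure_PiM \<open>finite I\<close>) (auto simp: A_def)
    \<comment> \<open>The other factors may have infinite measure, but in \<open>ennreal\<close> a
      product with a factor 0 is 0.\<close>
    also have "\<dots> = 0"
      using i S \<open>finite I\<close> by (intro prod_zero) (auto simp: A_def)
    finally have "Pi\<^sub>E I A \<in> null_sets (Pi\<^sub>M I M)"
      using S \<open>finite I\<close> by (auto simp: null_sets_def A_def intro!: sets_PiM_I_finite)
    moreover have "{\<xi> \<in> space (Pi\<^sub>M I M). \<not> P i (\<xi> i)} \<subseteq> Pi\<^sub>E I A"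
      using S(3) i by (auto simp: space_PiM A_def PiE_iff extensional_def)
    ultimately show ?thesis by (rule AE_I')
  qed
  then show ?thesis using \<open>finite I\<close> by (simp add: AE_finite_all)
qed

text \<open>Fubini for products, with all measures completed. Each factor is replaced by an almost
  everywhere equal function measurable for the uncompleted measure; Fubini for the uncompleted
  product applies to these, and both sides are carried back.\<close>

lemma (in product_sigma_finite) completion_product_prod:
  fixes f :: "'i \<Rightarrow> 'a \<Rightarrow> complex"
  assumes I: "finite I" and f: "\<And>i. i \<in> I \<Longrightarrow> integrable (completion (M i)) (f i)"
  shows "integrable (completion (Pi\<^sub>M I M)) (\<lambda>\<xi>. \<Prod>i\<in>I. f i (\<xi> i))" (is ?int)
    and "(\<integral>\<xi>. (\<Prod>i\<in>I. f i (\<xi> i)) \<partial>completion (Pi\<^sub>M I M)) = (\<Prod>i\<in>I. \<integral>x. f i x \<partial>completion (M i))" (is ?eq)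
proof -
  have "\<forall>i\<in>I. \<exists>g\<in>borel_measurable (M i). AE x in M i. f i x = g x"
    using f by (intro ballI completion_ex_borel_measurable_complex) (auto dest: borel_measurable_integrable)
  then obtain g where g: "\<And>i. i \<in> I \<Longrightarrow> g i \<in> borel_measurable (M i)"
    and fg: "\<And>i. i \<in> I \<Longrightarrow> AE x in M i. f i x = g i x"
    by metis
  have fg': "AE x in completion (M i). f i x = g i x" if "i \<in> I" for i
    using fg[OF that] by (rule AE_completion)
  have g': "g i \<in> borel_measurable (completion (M i))" if "i \<in> I" for i
    using g[OF that] by (rule measurable_completion)
  have gi: "integrable (M i) (g i)" if "i \<in> I" for i
  proof -
    have "integrable (completion (M i)) (g i)"
      using integrable_cong_AE[OF borel_measurable_integrable[OF f[OF that]] g'[OF that] fg'[OF that]] f[OF that]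
      by simp
    then show ?thesis using integrable_completion[OF g[OF that]] by simp
  qed
  have int_fg: "(\<integral>x. f i x \<partial>completion (M i)) = (\<integral>x. g i x \<partial>M i)" if "i \<in> I" for i
    using integral_cong_AE[OF borel_measurable_integrable[OF f[OF that]] g'[OF that] fg'[OF that]]
      integral_completion[OF g[OF that]] by simp
  have G: "(\<lambda>\<xi>. \<Prod>i\<in>I. g i (\<xi> i)) \<in> borel_measurable (Pi\<^sub>M I M)"
    by (rule borel_measurable_integrable[OF product_integrable_prod[OF I gi]])
  then have G': "(\<lambda>\<xi>. \<Prod>i\<in>I. g i (\<xi> i)) \<in> borel_measurable (completion (Pi\<^sub>M I M))"
    by (rule measurable_completion)
  have "AE \<xi> in Pi\<^sub>M I M. \<forall>i\<in>I. f i (\<xi> i) = g i (\<xi> i)"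
    by (rule AE_PiM_finite[OF I fg])
  then have ae: "AE \<xi> in completion (Pi\<^sub>M I M). (\<Prod>i\<in>I. f i (\<xi> i)) = (\<Prod>i\<in>I. g i (\<xi> i))"
    by (intro AE_completion) (auto elim!: eventually_mono intro!: prod.cong)
  note F' = borel_measurable_completion_cong_AE[OF G' ae]
  show ?int
    using integrable_cong_AE[OF F' G' ae] integrable_completion[OF G] product_integrable_prod[OF I gi] by simp
  show ?eq
    using integral_cong_AE[OF F' G' ae] integral_completion[OF G] product_integral_prod[OF I gi]
    by (simp add: int_fg)
qed

section \<open>Integration over particle variables\<close>

lemma product_sigma_finite_particle_borel: "product_sigma_finite (\<lambda>_. particle_borel)"
proof -
  interpret S: sigma_finite_measure "count_space spins"
    by (rule sigma_finite_measure_count_space_finite) (simp add: spins_def)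
  interpret pair_sigma_finite "lborel :: (real ^ 3) measure" "count_space spins" ..
  show ?thesis
    unfolding product_sigma_finite_def particle_borel_def using sigma_finite_measure_axioms by blast
qed

text \<open>Dominated by the sum of the two squared moduli; makes the overlap integrals
  converge.\<close>

lemma integrable_mult_cnj:
  assumes "square_integrable f" "square_integrable g"
  shows "integrable particle_measure (\<lambda>\<gamma>. f \<gamma> * cnj (g \<gamma>))"
proof (rule Bochner_Integration.integrable_bound)
  show "integrable particle_measure (\<lambda>\<gamma>. (cmod (f \<gamma>))\<^sup>2 + (cmod (g \<gamma>))\<^sup>2)"
    using assms by (auto simp: square_integrable_def)
  have "cnj \<in> borel_measurable borel"
    by (intro borel_measurable_continuous_onI continuous_on_cnj continuous_on_id)
  then have "(\<lambda>\<gamma>. cnj (g \<gamma>)) \<in> borel_measurable particle_measure"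
    using assms(2) unfolding square_integrable_def by (blast intro: measurable_compose)
  then show "(\<lambda>\<gamma>. f \<gamma> * cnj (g \<gamma>)) \<in> borel_measurable particle_measure"
    using assms(1) unfolding square_integrable_def by (intro borel_measurable_times) auto
  have "a * b \<le> a\<^sup>2 + b\<^sup>2" if "0 \<le> a" "0 \<le> b" for a b :: real
    using sum_squares_bound[of a b] that mult_nonneg_nonneg[OF that] by linarith
  then show "AE \<gamma> in particle_measure. norm (f \<gamma> * cnj (g \<gamma>)) \<le> norm ((cmod (f \<gamma>))\<^sup>2 + (cmod (g \<gamma>))\<^sup>2)"
    by (simp add: norm_mult)
qed

section \<open>The antisymmetric inner product\<close>

text \<open>This serves as the matrix \<open>K\<close> of \<open>sum_det_replace_col\<close>, whose
  row 0 may be chosen freely. Filling it with the inner products against \<open>\<phi>t 0\<close>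
  makes the product with the inverse of \<open>E_matrix\<close> consist of integrals against
  \<open>Theta\<close>.\<close>

definition one_op_matrix :: "nat \<Rightarrow> nuclei \<Rightarrow> (nat \<Rightarrow> orbital) \<Rightarrow> (nat \<Rightarrow> orbital) \<Rightarrow> complex mat" where
  "one_op_matrix N nuc \<phi> \<phi>t = mat N N (\<lambda>(i, j). orb_inner (\<phi>t i) (one_op nuc (\<phi> j)))"

text \<open>Summing over inverse permutations, which have the same signs, moves the permutation from
  the particles to the orbitals. Afterwards \<open>k\<close> names the orbital hit by the operator.
  Any orbital may meet any particle, so definedness is assumed for all pairs.\<close>

lemma antisymmetrizer_many_op_orb_product:
  assumes "\<And>i j. i < N \<Longrightarrow> j < N \<Longrightarrow> one_op_defined_at nuc (\<phi> j) (\<xi> i)"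
  shows "antisymmetrizer N (many_op N nuc (orb_product N \<phi>)) \<xi> =
    (\<Sum>\<pi> | \<pi> permutes {..<N}. of_int (sign \<pi>) *
      (\<Sum>k<N. \<Prod>i<N. (if \<pi> i = k then one_op nuc (\<phi> k) else \<phi> (\<pi> i)) (\<xi> i))) / fact N"
proof -
  have "many_op N nuc (orb_product N \<phi>) (\<lambda>i. \<xi> (Hilbert_Choice.inv \<pi> i)) =
      (\<Sum>k<N. \<Prod>i<N. (if \<pi> i = k then one_op nuc (\<phi> k) else \<phi> (\<pi> i)) (\<xi> i))"
    if \<pi>: "\<pi> permutes {..<N}" for \<pi>
  proof -
    have "Hilbert_Choice.inv \<pi> i < N" if "i < N" for i
      using permutes_in_image[OF permutes_inv[OF \<pi>]] that by auto
    then have "many_op N nuc (orb_product N \<phi>) (\<lambda>i. \<xi> (Hilbert_Choice.inv \<pi> i)) =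
        (\<Sum>k<N. \<Prod>i<N. (if i = k then one_op nuc (\<phi> k) else \<phi> i) (\<xi> (Hilbert_Choice.inv \<pi> i)))"
      using assms by (intro many_op_orb_product) auto
    also have "\<dots> = (\<Sum>k<N. \<Prod>i<N. (if \<pi> i = k then one_op nuc (\<phi> k) else \<phi> (\<pi> i)) (\<xi> i))"
      by (subst prod.permute[OF \<pi>]) (simp add: o_def permutes_inverses[OF \<pi>])
    finally show ?thesis .
  qed
  moreover have "permutation \<pi>" if "\<pi> permutes {..<N}" for \<pi>
    using that permutation_permutes by blast
  ultimately show ?thesis
    unfolding antisymmetrizer_def
    by (subst sum_permutations_inverse) (auto intro!: sum.cong arg_cong2[where f = "(/)"] simp: sign_inverse)
qed

lemma AE_particle_one_op_defined:
  assumes "admissible N nuc \<phi> \<phi>t"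
  shows "AE \<gamma> in particle_measure. \<forall>j<N. one_op_defined_at nuc (\<phi> j) \<gamma>"
proof -
  have "\<forall>j\<in>{..<N}. AE \<gamma> in particle_measure. one_op_defined_at nuc (\<phi> j) \<gamma>"
    using assms by (simp add: admissible_def one_op_defined_def)
  then have "AE \<gamma> in particle_measure. \<forall>j\<in>{..<N}. one_op_defined_at nuc (\<phi> j) \<gamma>"
    by (subst AE_finite_all) auto
  then show ?thesis by (rule eventually_mono) simp
qed

text \<open>For fixed \<open>k\<close> the expansion over permutations is a Leibniz formula:
  particle 0, held at \<open>\<gamma>\<close>, supplies row 0, and by Fubini each other particle
  supplies a row of inner products. In \<open>g k\<close> the orbital \<open>k\<close> has been hit
  by the one-particle operator.\<close>

lemma delta_inner_A_eq_sum_det: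
  assumes N: "1 \<le> N" and adm: "admissible N nuc \<phi> \<phi>t"
    and \<gamma>: "\<And>j. j < N \<Longrightarrow> one_op_defined_at nuc (\<phi> j) \<gamma>"
  defines "g \<equiv> \<lambda>k j. if j = k then one_op nuc (\<phi> k) else \<phi> j"
  shows "delta_inner_A N \<phi>t (many_op N nuc (orb_product N \<phi>)) \<gamma> =
    (\<Sum>k<N. Determinant.det (mat N N (\<lambda>(i, j). if i = 0 then cnj (g k j \<gamma>) else orb_inner (\<phi>t i) (g k j)))) / fact N"
proof -
  interpret product_sigma_finite "\<lambda>_ :: nat. particle_borel" by (rule product_sigma_finite_particle_borel)
  let ?P = "{\<pi>. \<pi> permutes {..<N}}"
  let ?f = "\<lambda>\<pi> k i x. \<phi>t i x * cnj (g k (\<pi> i) x)"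
  let ?c = "\<lambda>\<pi> k. of_int (sign \<pi>) * cnj (g k (\<pi> 0) \<gamma>) / fact N"
  let ?L = "\<lambda>\<xi>. (\<Prod>i=1..<N. \<phi>t i (\<xi> i)) *
      cnj (antisymmetrizer N (many_op N nuc (orb_product N \<phi>)) (\<xi>(0 := \<gamma>)))"
  \<comment> \<open>\<open>?R\<close> is the expansion of the integrand \<open>?L\<close> into
    products of functions of a single particle each, the form that Fubini needs.\<close>
  let ?R = "\<lambda>\<xi>. \<Sum>\<pi>\<in>?P. \<Sum>k<N. ?c \<pi> k * (\<Prod>i\<in>{1..<N}. ?f \<pi> k i (\<xi> i))"
  have N0: "{..<N} = insert 0 {1..<N}" using N by auto
  have \<pi>N: "\<pi> i < N" if "\<pi> \<in> ?P" "i < N" for \<pi> i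
    using permutes_in_image[of \<pi> "{..<N}" i] that by auto
  \<comment> \<open>If \<open>\<pi> i = k\<close>, this is the integrability in
    \<open>admissible\<close> for the operator; otherwise it is square integrability.\<close>
  have int_f: "integrable (completion particle_borel) (?f \<pi> k i)"
    if "\<pi> \<in> ?P" "k < N" "i \<in> {1..<N}" for \<pi> k i
  proof -
    have "i < N" "\<pi> i < N" using that \<pi>N by auto
    then show ?thesis
      using adm integrable_mult_cnj unfolding particle_measure_def[symmetric] g_def admissible_def
      by (cases "\<pi> i = k") simp_all
  qed
  note prod_f = completion_product_prod[of "{1..<N}", OF finite_atLeastLessThan int_f, folded rest_measure_def]
  have R: "integrable (rest_measure N) ?R"
    by (intro Bochner_Integration.integrable_sum integrable_mult_right prod_f(1)) auto
  \<comment> \<open>The expansion holds only where the operator is defined: for almost every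
    position of the integrated particles, and by assumption at \<open>\<gamma>\<close>.\<close>
  have "AE \<xi> in rest_measure N. \<forall>i\<in>{1..<N}. \<forall>j<N. one_op_defined_at nuc (\<phi> j) (\<xi> i)"
    unfolding rest_measure_def
    using AE_particle_one_op_defined[OF adm, unfolded particle_measure_def AE_completion_iff]
    by (intro AE_completion AE_PiM_finite) auto
  then have LR: "AE \<xi> in rest_measure N. ?L \<xi> = ?R \<xi>"
  proof eventually_elim
    case (elim \<xi>)
    have "antisymmetrizer N (many_op N nuc (orb_product N \<phi>)) (\<xi>(0 := \<gamma>)) =
      (\<Sum>\<pi>\<in>?P. of_int (sign \<pi>) *
        (\<Sum>k<N. \<Prod>i<N. (if \<pi> i = k then one_op nuc (\<phi> k) else \<phi> (\<pi> i)) ((\<xi>(0 := \<gamma>)) i))) / fact N"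
      using elim \<gamma> by (intro antisymmetrizer_many_op_orb_product) auto
    also have "\<dots> = (\<Sum>\<pi>\<in>?P. \<Sum>k<N. of_int (sign \<pi>) / fact N * (g k (\<pi> 0) \<gamma> * (\<Prod>i\<in>{1..<N}. g k (\<pi> i) (\<xi> i))))"
    proof -
      have "(\<Prod>i<N. (if \<pi> i = k then one_op nuc (\<phi> k) else \<phi> (\<pi> i)) ((\<xi>(0 := \<gamma>)) i)) =
          g k (\<pi> 0) \<gamma> * (\<Prod>i\<in>{1..<N}. g k (\<pi> i) (\<xi> i))" for \<pi> k
        unfolding N0 g_def by (subst prod.insert) (auto intro!: arg_cong2[where f = "(*)"] prod.cong)
      then show ?thesis by (simp add: sum_divide_distrib sum_distrib_left)
    qed
    finally show ?case
      by (simp add: sum_distrib_left prod.distrib mult_ac)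
  qed
  have "delta_inner_A N \<phi>t (many_op N nuc (orb_product N \<phi>)) \<gamma> = integral\<^sup>L (rest_measure N) ?R"
    unfolding delta_inner_A_def
    using borel_measurable_completion_cong_AE[OF borel_measurable_integrable[OF R, unfolded rest_measure_def]
        LR[unfolded rest_measure_def]] borel_measurable_integrable[OF R] LR
    by (intro integral_cong_AE) (simp_all add: rest_measure_def)
  also have "\<dots> = (\<Sum>\<pi>\<in>?P. \<Sum>k<N. ?c \<pi> k * (\<Prod>i\<in>{1..<N}. orb_inner (\<phi>t i) (g k (\<pi> i))))"
  proof -
    have "integral\<^sup>L (rest_measure N) ?R =
        (\<Sum>\<pi>\<in>?P. \<Sum>k<N. \<integral>\<xi>. ?c \<pi> k * (\<Prod>i\<in>{1..<N}. ?f \<pi> k i (\<xi> i)) \<partial>rest_measure N)"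
      by (subst Bochner_Integration.integral_sum,
          (intro Bochner_Integration.integrable_sum integrable_mult_right prod_f(1); simp),
          intro sum.cong refl Bochner_Integration.integral_sum integrable_mult_right prod_f(1)) auto
    also have "\<dots> = (\<Sum>\<pi>\<in>?P. \<Sum>k<N. ?c \<pi> k * (\<Prod>i\<in>{1..<N}. orb_inner (\<phi>t i) (g k (\<pi> i))))"
    proof (intro sum.cong refl)
      fix \<pi> k assume *: "\<pi> \<in> ?P" "k \<in> {..<N}"
      have "(\<integral>\<xi>. (\<Prod>i\<in>{1..<N}. ?f \<pi> k i (\<xi> i)) \<partial>rest_measure N) = (\<Prod>i\<in>{1..<N}. orb_inner (\<phi>t i) (g k (\<pi> i)))"
        unfolding orb_inner_def particle_measure_def by (rule prod_f(2)) (use * in auto)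
      then show "(\<integral>\<xi>. ?c \<pi> k * (\<Prod>i\<in>{1..<N}. ?f \<pi> k i (\<xi> i)) \<partial>rest_measure N) =
          ?c \<pi> k * (\<Prod>i\<in>{1..<N}. orb_inner (\<phi>t i) (g k (\<pi> i)))"
        by (simp only: integral_mult_right_zero)
    qed
    finally show ?thesis .
  qed
  also have "\<dots> = (\<Sum>k<N. \<Sum>\<pi>\<in>?P. of_int (sign \<pi>) *
      (\<Prod>i<N. if i = 0 then cnj (g k (\<pi> i) \<gamma>) else orb_inner (\<phi>t i) (g k (\<pi> i)))) / fact N"
    unfolding N0 by (subst sum.swap) (simp add: sum_divide_distrib add_divide_distrib mult_ac)
  also have "\<dots> = (\<Sum>k<N. Determinant.det (mat N N (\<lambda>(i, j). if i = 0 then cnj (g k j \<gamma>) else orb_inner (\<phi>t i) (g k j)))) / fact N"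
  proof (rule arg_cong[where f = "\<lambda>x. x / fact N"], rule sum.cong[OF refl])
    fix k
    show "(\<Sum>\<pi>\<in>?P. of_int (sign \<pi>) * (\<Prod>i<N. if i = 0 then cnj (g k (\<pi> i) \<gamma>) else orb_inner (\<phi>t i) (g k (\<pi> i)))) =
      Determinant.det (mat N N (\<lambda>(i, j). if i = 0 then cnj (g k j \<gamma>) else orb_inner (\<phi>t i) (g k j)))"
      by (subst det_def'[of _ N], simp, unfold lessThan_atLeast0,
          intro sum.cong refl arg_cong2[where f = "(*)"] prod.cong)
        (auto simp: permutes_in_image)
  qed
  finally show ?thesis .
qed

section \<open>Matrix inverses and the closed formula\<close>

lemma mat_inverse_det_nonzero:
  fixes A :: "'a :: field mat"
  assumes A: "A \<in> carrier_mat n n" and det: "Determinant.det A \<noteq> 0"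
  shows "\<exists>B. mat_inverse A = Some B \<and> B \<in> carrier_mat n n \<and> A * B = 1\<^sub>m n"
proof (cases "mat_inverse A")
  case None
  have "A \<in> Units (ring_mat TYPE('a) n ())" by (rule det_non_zero_imp_unit[OF A det])
  then show ?thesis using mat_inverse(1)[OF A None, of "()"] by simp
next
  case (Some B)
  then show ?thesis using mat_inverse(2)[OF A] by blast
qed

lemma invertible_mat_det_nonzero:
  fixes A :: "'a :: field mat"
  assumes A: "A \<in> carrier_mat n n" and inv: "invertible_mat A"
  shows "Determinant.det A \<noteq> 0"
proof -
  from inv obtain B where B: "A * B = 1\<^sub>m n" "B * A = 1\<^sub>m (dim_row B)"
    using A by (auto simp: invertible_mat_def inverts_mat_def)
  have "dim_col B = n" "dim_row B = n"
    using arg_cong[OF B(1), of dim_col] arg_cong[OF B(2), of dim_col] A by simp_all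
  then have "B \<in> carrier_mat n n" by (intro carrier_matI)
  from det_mult[OF A this] have "Determinant.det A * Determinant.det B = 1"
    unfolding B(1) by simp
  then show ?thesis by auto
qed

text \<open>Row 0 gives the squared norm of \<open>d\<close>, which is 1; the other rows annihilate
  \<open>d\<close> by its choice.\<close>

lemma E_matrix_mult_null_vector:
  assumes "unit_null_vector N \<phi> \<phi>t d"
  shows "E_matrix N \<phi> \<phi>t d *\<^sub>v d = unit_vec N 0"
proof (rule eq_vecI)
  have d: "d \<in> carrier_vec N" "(\<Sum>j<N. (cmod (d $ j))\<^sup>2) = 1"
    "\<And>i. i \<in> {1..<N} \<Longrightarrow> (\<Sum>j<N. orb_inner (\<phi>t i) (\<phi> j) * d $ j) = 0"
    using assms by (auto simp: unit_null_vector_def)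
  fix i assume "i < dim_vec (unit_vec N 0 :: complex vec)"
  then have i: "i < N" by simp
  have "(E_matrix N \<phi> \<phi>t d *\<^sub>v d) $ i = (\<Sum>j<N. (if i = 0 then cnj (d $ j) else orb_inner (\<phi>t i) (\<phi> j)) * d $ j)"
    using i d(1) by (simp add: E_matrix_def scalar_prod_def lessThan_atLeast0)
  also have "\<dots> = (if i = 0 then 1 else 0)"
  proof (cases "i = 0")
    case True
    have "(\<Sum>j<N. cnj (d $ j) * d $ j) = complex_of_real (\<Sum>j<N. (cmod (d $ j))\<^sup>2)"
      unfolding of_real_sum by (intro sum.cong refl) (metis complex_norm_square mult.commute)
    then show ?thesis using True d(2) by simp
  next
    case False
    then show ?thesis using d(3)[of i] i by simp
  qed
  finally show "(E_matrix N \<phi> \<phi>t d *\<^sub>v d) $ i = unit_vec N 0 $ i" using i by simp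
qed (simp add: E_matrix_def)

text \<open>The formula in terms of the matrix \<open>Q\<close>, before its entries are read as
  integrals against \<open>Theta\<close>. The stated formula and the correctness of the program both
  start from here.\<close>

lemma delta_inner_A_formula:
  assumes N: "1 \<le> N" and adm: "admissible N nuc \<phi> \<phi>t"
    and d: "unit_null_vector N \<phi> \<phi>t d"
    and B: "B \<in> carrier_mat N N" "E_matrix N \<phi> \<phi>t d * B = 1\<^sub>m N"
    and \<gamma>: "\<And>j. j < N \<Longrightarrow> one_op_defined_at nuc (\<phi> j) \<gamma>"
  defines "Q \<equiv> B * one_op_matrix N nuc \<phi> \<phi>t"
  shows "delta_inner_A N \<phi>t (many_op N nuc (orb_product N \<phi>)) \<gamma> =
    Determinant.det (E_matrix N \<phi> \<phi>t d) / fact N *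
      ((\<Sum>j<N. cnj (\<phi> j \<gamma>) * (d $ j * (\<Sum>k<N. Q $$ (k, k)) - (\<Sum>k<N. Q $$ (j, k) * d $ k)))
        + (\<Sum>k<N. cnj (one_op nuc (\<phi> k) \<gamma>) * d $ k))"
proof -
  let ?g = "\<lambda>k j. if j = k then one_op nuc (\<phi> k) else \<phi> j"
  let ?M = "mat N N (\<lambda>(i, j). if i = 0 then cnj (\<phi> j \<gamma>) else orb_inner (\<phi>t i) (\<phi> j))"
  let ?H = "mat N N (\<lambda>(i, j). if i = 0 then cnj (one_op nuc (\<phi> j) \<gamma>) else orb_inner (\<phi>t i) (one_op nuc (\<phi> j)))"
  have "mat N N (\<lambda>(i, j). if i = 0 then cnj (?g k j \<gamma>) else orb_inner (\<phi>t i) (?g k j)) =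
      replace_col ?M (col ?H k) k" if "k < N" for k
    using that by (intro eq_matI) (auto simp: replace_col_def)
  then have "delta_inner_A N \<phi>t (many_op N nuc (orb_product N \<phi>)) \<gamma> =
      (\<Sum>k<N. Determinant.det (replace_col ?M (col ?H k) k)) / fact N"
    using delta_inner_A_eq_sum_det[OF N adm \<gamma>] by simp
  also have "(\<Sum>k<N. Determinant.det (replace_col ?M (col ?H k) k)) =
    Determinant.det (E_matrix N \<phi> \<phi>t d) *
      ((\<Sum>j<N. ?M $$ (0, j) * (d $ j * (\<Sum>k<N. (B * one_op_matrix N nuc \<phi> \<phi>t) $$ (k, k))
         - (\<Sum>k<N. (B * one_op_matrix N nuc \<phi> \<phi>t) $$ (j, k) * d $ k)))
       + (\<Sum>k<N. ?H $$ (0, k) * d $ k))"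
    using N d E_matrix_mult_null_vector[OF d]
    by (intro sum_det_replace_col[OF _ B])
      (auto simp: E_matrix_def one_op_matrix_def unit_null_vector_def)
  finally show ?thesis using N by (simp add: Q_def)
qed

text \<open>\<open>Theta i\<close> combines the \<open>\<phi>t j\<close> with the entries of row
  \<open>i\<close> of the inverse, so linearity of the integral yields a matrix product. Its trace
  is the first integral of the formula; applied to \<open>d\<close>, it gives the second.\<close>

lemma integral_Theta:
  assumes adm: "admissible N nuc \<phi> \<phi>t"
    and B: "B \<in> carrier_mat N N" "mat_inverse (E_matrix N \<phi> \<phi>t d) = Some B"
    and i: "i < N" and k: "k < N"
  shows "integrable particle_measure (\<lambda>\<gamma>. cnj (one_op nuc (\<phi> k) \<gamma>) * Theta N \<phi> \<phi>t d i \<gamma>)"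
    and "(\<integral>\<gamma>. cnj (one_op nuc (\<phi> k) \<gamma>) * Theta N \<phi> \<phi>t d i \<gamma> \<partial>particle_measure) =
      (B * one_op_matrix N nuc \<phi> \<phi>t) $$ (i, k)"
proof -
  have eq: "(\<lambda>\<gamma>. cnj (one_op nuc (\<phi> k) \<gamma>) * Theta N \<phi> \<phi>t d i \<gamma>) =
      (\<lambda>\<gamma>. \<Sum>j<N. B $$ (i, j) * (\<phi>t j \<gamma> * cnj (one_op nuc (\<phi> k) \<gamma>)))"
    by (simp add: Theta_def B(2) sum_distrib_left mult_ac)
  have int: "integrable particle_measure (\<lambda>\<gamma>. B $$ (i, j) * (\<phi>t j \<gamma> * cnj (one_op nuc (\<phi> k) \<gamma>)))" if "j < N" for j
    using adm that k by (intro integrable_mult_right) (simp add: admissible_def)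
  show "integrable particle_measure (\<lambda>\<gamma>. cnj (one_op nuc (\<phi> k) \<gamma>) * Theta N \<phi> \<phi>t d i \<gamma>)"
    unfolding eq by (intro Bochner_Integration.integrable_sum int) simp
  have "(\<integral>\<gamma>. cnj (one_op nuc (\<phi> k) \<gamma>) * Theta N \<phi> \<phi>t d i \<gamma> \<partial>particle_measure) =
      (\<Sum>j<N. \<integral>\<gamma>. B $$ (i, j) * (\<phi>t j \<gamma> * cnj (one_op nuc (\<phi> k) \<gamma>)) \<partial>particle_measure)"
    unfolding eq by (intro Bochner_Integration.integral_sum int) simp
  also have "\<dots> = (\<Sum>j<N. B $$ (i, j) * one_op_matrix N nuc \<phi> \<phi>t $$ (j, k))"
    using k by (simp add: one_op_matrix_def orb_inner_def)
  also have "\<dots> = (B * one_op_matrix N nuc \<phi> \<phi>t) $$ (i, k)"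
    using B(1) i k by (simp add: scalar_prod_def lessThan_atLeast0 one_op_matrix_def)
  finally show "(\<integral>\<gamma>. cnj (one_op nuc (\<phi> k) \<gamma>) * Theta N \<phi> \<phi>t d i \<gamma> \<partial>particle_measure) =
      (B * one_op_matrix N nuc \<phi> \<phi>t) $$ (i, k)" .
qed

lemma delta_inner_A_Theta:
  assumes N: "1 \<le> N" and adm: "admissible N nuc \<phi> \<phi>t"
    and d: "unit_null_vector N \<phi> \<phi>t d"
    and inv: "invertible_mat (E_matrix N \<phi> \<phi>t d)"
    and \<gamma>: "\<And>j. j < N \<Longrightarrow> one_op_defined_at nuc (\<phi> j) \<gamma>"
  shows "delta_inner_A N \<phi>t (many_op N nuc (orb_product N \<phi>)) \<gamma> =
    Determinant.det (E_matrix N \<phi> \<phi>t d) / fact N *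
      ((\<Sum>j<N. cnj (\<phi> j \<gamma>) *
          (d $ j * (\<integral>\<gamma>'. (\<Sum>k<N. cnj (one_op nuc (\<phi> k) \<gamma>') * Theta N \<phi> \<phi>t d k \<gamma>') \<partial>particle_measure)
           - (\<integral>\<gamma>'. one_op nuc (\<lambda>\<gamma>''. \<Sum>k<N. cnj (\<phi> k \<gamma>'') * d $ k) \<gamma>' * Theta N \<phi> \<phi>t d j \<gamma>' \<partial>particle_measure)))
       + one_op nuc (\<lambda>\<gamma>''. \<Sum>k<N. cnj (\<phi> k \<gamma>'') * d $ k) \<gamma>)"
proof -
  have "E_matrix N \<phi> \<phi>t d \<in> carrier_mat N N" by (simp add: E_matrix_def)
  \<comment> \<open>This also shows that \<open>the\<close> in \<open>Theta\<close> is applied to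
    \<open>Some B\<close>, so that \<open>Theta\<close> is built from a genuine inverse.\<close>
  from mat_inverse_det_nonzero[OF this invertible_mat_det_nonzero[OF this inv]] obtain B where
    B: "mat_inverse (E_matrix N \<phi> \<phi>t d) = Some B" "B \<in> carrier_mat N N" "E_matrix N \<phi> \<phi>t d * B = 1\<^sub>m N"
    by blast
  note Th = integral_Theta[OF adm B(2,1)]
  have 1: "(\<integral>\<gamma>'. (\<Sum>k<N. cnj (one_op nuc (\<phi> k) \<gamma>') * Theta N \<phi> \<phi>t d k \<gamma>') \<partial>particle_measure) =
      (\<Sum>k<N. (B * one_op_matrix N nuc \<phi> \<phi>t) $$ (k, k))"
    by (subst Bochner_Integration.integral_sum) (auto simp: Th)
  have 2: "(\<integral>\<gamma>'. one_op nuc (\<lambda>\<gamma>''. \<Sum>k<N. cnj (\<phi> k \<gamma>'') * d $ k) \<gamma>' * Theta N \<phi> \<phi>t d j \<gamma>' \<partial>particle_measure) =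
      (\<Sum>k<N. (B * one_op_matrix N nuc \<phi> \<phi>t) $$ (j, k) * d $ k)" if j: "j < N" for j
  proof -
    let ?R = "\<lambda>\<gamma>'. \<Sum>k<N. cnj (one_op nuc (\<phi> k) \<gamma>') * Theta N \<phi> \<phi>t d j \<gamma>' * d $ k"
    have R: "integrable particle_measure ?R"
      by (intro Bochner_Integration.integrable_sum integrable_mult_left Th(1) j) simp
    \<comment> \<open>Under the integral the operator can be pulled through the combination only
      almost everywhere; at the outer \<open>\<gamma>\<close> this holds exactly, by
      assumption.\<close>
    have ae: "AE \<gamma>' in particle_measure.
        one_op nuc (\<lambda>\<gamma>''. \<Sum>k<N. cnj (\<phi> k \<gamma>'') * d $ k) \<gamma>' * Theta N \<phi> \<phi>t d j \<gamma>' = ?R \<gamma>'"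
      using AE_particle_one_op_defined[OF adm]
      by eventually_elim (subst one_op_conj_combination, simp, simp add: sum_distrib_left sum_distrib_right mult_ac)
    have "(\<integral>\<gamma>'. one_op nuc (\<lambda>\<gamma>''. \<Sum>k<N. cnj (\<phi> k \<gamma>'') * d $ k) \<gamma>' * Theta N \<phi> \<phi>t d j \<gamma>' \<partial>particle_measure) =
        integral\<^sup>L particle_measure ?R"
      using borel_measurable_completion_cong_AE[OF borel_measurable_integrable[OF R, unfolded particle_measure_def]
          ae[unfolded particle_measure_def]] borel_measurable_integrable[OF R] ae
      by (intro integral_cong_AE) (simp_all add: particle_measure_def)
    also have "\<dots> = (\<Sum>k<N. (B * one_op_matrix N nuc \<phi> \<phi>t) $$ (j, k) * d $ k)"
      by (subst Bochner_Integration.integral_sum) (auto simp: Th j)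
    finally show ?thesis .
  qed
  show ?thesis
    using delta_inner_A_formula[OF N adm d B(2,3) \<gamma>] one_op_conj_combination[of N nuc \<phi> \<gamma> "\<lambda>k. d $ k"] \<gamma>
    by (simp add: 1 2)
qed

section \<open>Null vectors and singular values\<close>

lemma mat_adjoint_carrier:
  "A \<in> carrier_mat n n \<Longrightarrow> mat_adjoint A \<in> carrier_mat n n"
  by (auto simp: mat_adjoint_def mat_of_rows_def)

lemma mat_adjoint_index:
  assumes "A \<in> carrier_mat n n" "i < n" "j < n"
  shows "mat_adjoint A $$ (i, j) = cnj (A $$ (j, i))"
  using assms by (auto simp: mat_adjoint_def mat_of_rows_def conjugate_complex_def)

text \<open>A singular matrix has a vanishing singular value, and by the descending order the last
  one vanishes. Since \<open>A * V = U * S\<close>, the last column of \<open>V\<close> is then in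
  the kernel; it has norm 1 because \<open>V\<close> is unitary.\<close>

lemma svd_last_column:
  assumes N: "1 \<le> N" and A: "A \<in> carrier_mat N N" and svd: "is_svd N A (U, S, V)"
    and det: "Determinant.det A = 0"
  shows "A *\<^sub>v col V (N - 1) = 0\<^sub>v N" and "(\<Sum>j<N. (cmod (V $$ (j, N - 1)))\<^sup>2) = 1"
proof -
  let ?n = "N - 1"
  have n: "?n < N" using N by simp
  have U: "U \<in> carrier_mat N N" and S: "S \<in> carrier_mat N N" and V: "V \<in> carrier_mat N N"
    and UU: "U * mat_adjoint U = 1\<^sub>m N" and VV: "mat_adjoint V * V = 1\<^sub>m N"
    and diag: "diagonal_mat S"
    and S_real: "\<And>i. i < N \<Longrightarrow> S $$ (i, i) \<in> \<real> \<and> 0 \<le> Re (S $$ (i, i))"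
    and S_desc: "\<And>i j. i \<le> j \<Longrightarrow> j < N \<Longrightarrow> Re (S $$ (j, j)) \<le> Re (S $$ (i, i))"
    and A_eq: "A = U * S * mat_adjoint V"
    using svd mat_adjoint_carrier[of V N]
    by (auto simp: is_svd_def inverts_mat_def)
  have U': "mat_adjoint U \<in> carrier_mat N N" and V': "mat_adjoint V \<in> carrier_mat N N"
    using U V by (simp_all add: mat_adjoint_carrier)
  have US: "U * S \<in> carrier_mat N N" using U S by simp
  have "Determinant.det U \<noteq> 0"
    using det_mult[OF U U'] UU by auto
  moreover have "Determinant.det (mat_adjoint V) \<noteq> 0"
    using det_mult[OF V' V] VV by auto
  ultimately have "Determinant.det S = 0"
    using det unfolding A_eq det_mult[OF US V'] det_mult[OF U S] by simp
  moreover have "Determinant.det S = (\<Prod>i = 0..<N. S $$ (i, i))"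
  proof -
    have "upper_triangular S"
      using diag S by (intro upper_triangularI) (auto simp: diagonal_mat_def)
    from det_upper_triangular[OF this S] show ?thesis using S by (simp add: prod_list_diag_prod)
  qed
  ultimately obtain i where i: "i < N" "S $$ (i, i) = 0"
    by (auto simp: prod_zero_iff)
  have "Re (S $$ (?n, ?n)) = 0"
    using S_desc[of i ?n] S_real[OF n] i n by auto
  then have "S $$ (?n, ?n) = 0"
    using S_real[OF n] by (auto elim!: Reals_cases)
  then have S0: "col S ?n = 0\<^sub>v N"
  proof (intro eq_vecI)
    fix i assume "i < dim_vec (0\<^sub>v N :: complex vec)"
    then show "col S ?n $ i = 0\<^sub>v N $ i"
      using \<open>S $$ (?n, ?n) = 0\<close> diag S n by (cases "i = ?n") (auto simp: diagonal_mat_def)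
  qed (use S in simp)
  have "A * V = U * S"
    unfolding A_eq assoc_mult_mat[OF US V' V] VV by (rule right_mult_one_mat[OF US])
  then have "A *\<^sub>v col V ?n = U *\<^sub>v col S ?n"
    using col_mult2[OF A V n] col_mult2[OF U S n] by simp
  also have "\<dots> = 0\<^sub>v N" unfolding S0 using U by (intro eq_vecI) auto
  finally show "A *\<^sub>v col V ?n = 0\<^sub>v N" .
  have "(\<Sum>j<N. cnj (V $$ (j, ?n)) * V $$ (j, ?n)) = (mat_adjoint V * V) $$ (?n, ?n)"
    using n V carrier_matD[OF V'] by (simp add: scalar_prod_def lessThan_atLeast0 mat_adjoint_index[OF V])
  also have "\<dots> = 1" using VV n by simp
  finally have "complex_of_real (\<Sum>j<N. (cmod (V $$ (j, ?n)))\<^sup>2) = 1"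
    unfolding of_real_sum by (simp add: complex_norm_square mult.commute del: of_real_power)
  then show "(\<Sum>j<N. (cmod (V $$ (j, ?n)))\<^sup>2) = 1"
    using of_real_eq_1_iff by blast
qed

text \<open>Two unit null vectors differ by a phase factor, hence the corresponding matrices by a
  factor in their first rows.\<close>

lemma det_E_matrix_nonzero_cong:
  assumes N: "1 \<le> N" and d: "unit_null_vector N \<phi> \<phi>t d" and d': "unit_null_vector N \<phi> \<phi>t d'"
    and det': "Determinant.det (E_matrix N \<phi> \<phi>t d') \<noteq> 0"
  shows "Determinant.det (E_matrix N \<phi> \<phi>t d) \<noteq> 0"
proof -
  let ?E = "E_matrix N \<phi> \<phi>t d" and ?E' = "E_matrix N \<phi> \<phi>t d'"
  have E: "?E \<in> carrier_mat N N" and E': "?E' \<in> carrier_mat N N" by (simp_all add: E_matrix_def)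
  have dc: "d \<in> carrier_vec N" and dc': "d' \<in> carrier_vec N"
    using d d' by (auto simp: unit_null_vector_def)
  obtain B where B: "B \<in> carrier_mat N N" "B * ?E' = 1\<^sub>m N"
    using mat_inverse_det_nonzero[OF E' det'] mat_inverse(2)[OF E'] by blast
  \<comment> \<open>This is the phase: \<open>?E'\<close> maps \<open>d\<close> to \<open>s\<close>
    times the first unit vector, since its other rows annihilate \<open>d\<close>, and it maps
    \<open>d'\<close> to that unit vector itself. Cancelling \<open>?E'\<close> gives
    \<open>d = s d'\<close>.\<close>
  define s where "s = (\<Sum>j<N. cnj (d' $ j) * d $ j)"
  have "?E' *\<^sub>v d = s \<cdot>\<^sub>v unit_vec N 0"
  proof (rule eq_vecI)
    fix i assume "i < dim_vec (s \<cdot>\<^sub>v unit_vec N 0)"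
    then have i: "i < N" by simp
    have "(?E' *\<^sub>v d) $ i = (\<Sum>j<N. (if i = 0 then cnj (d' $ j) else orb_inner (\<phi>t i) (\<phi> j)) * d $ j)"
      using i dc by (simp add: E_matrix_def scalar_prod_def lessThan_atLeast0)
    then show "(?E' *\<^sub>v d) $ i = (s \<cdot>\<^sub>v unit_vec N 0) $ i"
      using i d by (cases "i = 0") (auto simp: s_def unit_null_vector_def)
  qed (simp add: E_matrix_def)
  also have "\<dots> = s \<cdot>\<^sub>v (?E' *\<^sub>v d')" by (simp add: E_matrix_mult_null_vector[OF d'])
  also have "\<dots> = ?E' *\<^sub>v (s \<cdot>\<^sub>v d')" using mult_mat_vec[OF E' dc'] by simp
  finally have "?E' *\<^sub>v d = ?E' *\<^sub>v (s \<cdot>\<^sub>v d')" .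
  then have "(B * ?E') *\<^sub>v d = (B * ?E') *\<^sub>v (s \<cdot>\<^sub>v d')"
    using assoc_mult_mat_vec[OF B(1) E' dc] assoc_mult_mat_vec[OF B(1) E', of "s \<cdot>\<^sub>v d'"] dc' by simp
  then have ds: "d = s \<cdot>\<^sub>v d'" using B(2) dc dc' by simp
  have "s \<noteq> 0"
  proof
    assume "s = 0"
    then have "(\<Sum>j<N. (cmod (d $ j))\<^sup>2) = 0" using ds dc' by auto
    then show False using d by (simp add: unit_null_vector_def)
  qed
  have "?E = multrow 0 (cnj s) ?E'"
    using dc' by (intro eq_matI) (auto simp: ds E_matrix_def)
  then have "Determinant.det ?E = cnj s * Determinant.det ?E'"
    using det_multrow[OF _ E', of 0 "cnj s"] N by simp
  then show ?thesis using det' \<open>s \<noteq> 0\<close> by simp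
qed

section \<open>Straight-line programs\<close>

lemma run_append:
  "run svd nuc N (P @ Q) m = Option.bind (run svd nuc N P m) (run svd nuc N Q)"
proof (induction P arbitrary: m)
  case (Cons c P)
  then show ?case by (cases "step svd nuc N c m") simp_all
qed simp

text \<open>Rule for an unrolled loop: \<open>I i\<close> is the invariant after \<open>i\<close>
  iterations. That a final memory exists includes that no instruction was undefined.\<close>

lemma run_loop:
  assumes "I 0 m" and "\<And>i m. i < n \<Longrightarrow> I i m \<Longrightarrow> \<exists>m'. run svd nuc N (P i) m = Some m' \<and> I (Suc i) m'"
  shows "\<exists>m'. run svd nuc N (concat (map P [0..<n])) m = Some m' \<and> I n m'"
  using assms(2)
proof (induction n)
  case 0
  then show ?case using assms(1) by simp
next
  case (Suc n)
  then obtain m1 where m1: "run svd nuc N (concat (map P [0..<n])) m = Some m1" "I n m1"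
    by (metis less_SucI)
  then show ?case using Suc.prems[of n m1] by (simp add: run_append)
qed

text \<open>The blocks may run in any order: each one establishes its own result and preserves those of
  the others.\<close>

lemma run_independent:
  assumes "J m"
    and "\<And>x m. x \<in> set xs \<Longrightarrow> J m \<Longrightarrow>
      \<exists>m'. run svd nuc N (P x) m = Some m' \<and> J m' \<and> R x m' \<and> (\<forall>y\<in>set xs. R y m \<longrightarrow> R y m')"
  shows "\<exists>m'. run svd nuc N (concat (map P xs)) m = Some m' \<and> J m' \<and> (\<forall>x\<in>set xs. R x m')"
proof -
  \<comment> \<open>The induction runs over \<open>ys\<close>, but preservation is kept for all of
    \<open>xs\<close>, so that results of earlier blocks survive the later ones.\<close>
  have "\<exists>m'. run svd nuc N (concat (map P ys)) m = Some m' \<and> J m' \<and>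
      (\<forall>x\<in>set ys. R x m') \<and> (\<forall>y\<in>set xs. R y m \<longrightarrow> R y m')"
    if "set ys \<subseteq> set xs" "J m" for ys m
    using that
  proof (induction ys arbitrary: m)
    case Nil
    then show ?case by simp
  next
    case (Cons x ys)
    obtain m1 where m1: "run svd nuc N (P x) m = Some m1" "J m1" "R x m1" "\<forall>y\<in>set xs. R y m \<longrightarrow> R y m1"
      using assms(2)[of x m] Cons.prems by auto
    obtain m2 where "run svd nuc N (concat (map P ys)) m1 = Some m2" "J m2"
      "\<forall>x\<in>set ys. R x m2" "\<forall>y\<in>set xs. R y m1 \<longrightarrow> R y m2"
      using Cons.IH[OF _ m1(2)] Cons.prems by auto
    then show ?case using m1 Cons.prems by (auto simp: run_append)
  qed
  from this[of xs m] show ?thesis using assms(1) by auto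
qed

text \<open>A frame condition: \<open>K\<close> and \<open>L\<close> are the matrix numbers and the
  function families that a block may alter.\<close>

definition same_off :: "nat set \<Rightarrow> nat set \<Rightarrow> memory \<Rightarrow> memory \<Rightarrow> bool" where
  "same_off K L m m' \<longleftrightarrow>
     (\<forall>k i j. k \<notin> K \<longrightarrow> scal m' (k, i, j) = scal m (k, i, j)) \<and>
     (\<forall>k i. k \<notin> L \<longrightarrow> func m' (k, i) = func m (k, i))"

lemma same_off_refl [simp]: "same_off K L m m"
  by (simp add: same_off_def)

lemma same_off_trans: "same_off K L m m' \<Longrightarrow> same_off K L m' m'' \<Longrightarrow> same_off K L m m''"
  by (simp add: same_off_def)

lemma same_off_scal: "same_off K L m m' \<Longrightarrow> k \<notin> K \<Longrightarrow> scal m' (k, i, j) = scal m (k, i, j)"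
  by (simp add: same_off_def)

lemma same_off_func: "same_off K L m m' \<Longrightarrow> k \<notin> L \<Longrightarrow> func m' (k, i) = func m (k, i)"
  by (simp add: same_off_def)

lemmas write_simps = write_scal_def write_func_def

section \<open>Building blocks of the program\<close>

definition conj_prog :: "nat \<Rightarrow> nat \<Rightarrow> nat \<Rightarrow> instr list" where
  "conj_prog k l n = concat (map (\<lambda>i. [FCnj (k, i) (l, i)]) [0..<n])"

definition op_prog :: "nat \<Rightarrow> nat \<Rightarrow> nat \<Rightarrow> instr list" where
  "op_prog k l n = concat (map (\<lambda>i. [FOp (k, i) (l, i)]) [0..<n])"

text \<open>Inner products arise when family \<open>g\<close> holds functions already conjugated.
  The list \<open>rs\<close> allows row 0 to be left out.\<close>

definition gram_prog :: "nat \<Rightarrow> nat \<Rightarrow> nat \<Rightarrow> nat \<Rightarrow> nat list \<Rightarrow> nat \<Rightarrow> instr list" where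
  "gram_prog k f g t rs n =
     concat (map (\<lambda>p. [FMul (t, 0) (f, fst p) (g, snd p), FInt (k, p) (t, 0)]) (List.product rs [0..<n]))"

text \<open>\<open>SSub c c c\<close> clears the accumulator, as there is no constant 0.\<close>

definition dot_prog :: "saddr \<Rightarrow> nat \<Rightarrow> (nat \<Rightarrow> saddr) \<Rightarrow> (nat \<Rightarrow> saddr) \<Rightarrow> nat \<Rightarrow> instr list" where
  "dot_prog c t a b n =
     SSub c c c # concat (map (\<lambda>i. [SMul (t, 0, 0) (a i) (b i), SAdd c c (t, 0, 0)]) [0..<n])"

definition mat_prog :: "nat \<Rightarrow> nat \<Rightarrow> nat \<Rightarrow> nat \<Rightarrow> nat \<Rightarrow> instr list" where
  "mat_prog k t l r n =
     concat (map (\<lambda>p. dot_prog (k, p) t (\<lambda>x. (l, fst p, x)) (\<lambda>x. (r, x, snd p)) n)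
       (List.product [0..<n] [0..<n]))"

definition row_conj_prog :: "nat \<Rightarrow> nat \<Rightarrow> nat \<Rightarrow> nat \<Rightarrow> instr list" where
  "row_conj_prog k l c n = concat (map (\<lambda>j. [SCnj (k, 0, j) (l, j, c)]) [0..<n])"

text \<open>\<open>t\<close> is a counter, raised before each multiplication; \<open>u\<close> is
  expected to hold 1.\<close>

definition fact_prog :: "saddr \<Rightarrow> saddr \<Rightarrow> saddr \<Rightarrow> nat \<Rightarrow> instr list" where
  "fact_prog c t u n =
     SOne c # SSub t t t # concat (map (\<lambda>i. [SAdd t t u, SMul c c t]) [0..<n])"

text \<open>The combination is added to whatever \<open>(k, 0)\<close> already holds, so that
  successive calls accumulate.\<close>

definition comb_prog :: "nat \<Rightarrow> nat \<Rightarrow> (nat \<Rightarrow> saddr) \<Rightarrow> (nat \<Rightarrow> faddr) \<Rightarrow> nat \<Rightarrow> instr list" where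
  "comb_prog k t s f n =
     concat (map (\<lambda>i. [FScale (t, 0) (s i) (f i), FAdd (k, 0) (k, 0) (t, 0)]) [0..<n])"

lemma run_conj_prog:
  assumes "k \<noteq> l"
  shows "\<exists>m'. run svd nuc N (conj_prog k l n) m = Some m' \<and> same_off {} {k} m m' \<and>
    (\<forall>i<n. func m' (k, i) = (\<lambda>\<gamma>. cnj (func m (l, i) \<gamma>)))"
proof -
  have "\<exists>m'. run svd nuc N (conj_prog k l n) m = Some m' \<and> same_off {} {k} m m' \<and>
    (\<forall>i\<in>set [0..<n]. func m' (k, i) = (\<lambda>\<gamma>. cnj (func m (l, i) \<gamma>)))"
    unfolding conj_prog_def
    by (rule run_independent) (use assms in \<open>auto simp: same_off_def write_simps\<close>)
  then show ?thesis by auto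
qed

lemma run_op_prog:
  assumes "k \<noteq> l" and "\<And>i. i < n \<Longrightarrow> one_op_defined nuc (func m (l, i))"
  shows "\<exists>m'. run svd nuc N (op_prog k l n) m = Some m' \<and> same_off {} {k} m m' \<and>
    (\<forall>i<n. func m' (k, i) = one_op nuc (func m (l, i)))"
proof -
  have "\<exists>m'. run svd nuc N (op_prog k l n) m = Some m' \<and> same_off {} {k} m m' \<and>
    (\<forall>i\<in>set [0..<n]. func m' (k, i) = one_op nuc (func m (l, i)))"
    unfolding op_prog_def
    by (rule run_independent) (use assms in \<open>auto simp: same_off_def write_simps\<close>)
  then show ?thesis by auto
qed

lemma run_gram_prog:
  assumes "t \<noteq> f" "t \<noteq> g"
    and "\<And>i j. i \<in> set rs \<Longrightarrow> j < n \<Longrightarrow> integrable particle_measure (\<lambda>\<gamma>. func m (f, i) \<gamma> * func m (g, j) \<gamma>)"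
  shows "\<exists>m'. run svd nuc N (gram_prog k f g t rs n) m = Some m' \<and> same_off {k} {t} m m' \<and>
    (\<forall>i j. scal m' (k, i, j) =
      (if i \<in> set rs \<and> j < n then \<integral>\<gamma>. func m (f, i) \<gamma> * func m (g, j) \<gamma> \<partial>particle_measure else scal m (k, i, j)))"
proof -
  let ?J = "\<lambda>m'. same_off {k} {t} m m' \<and>
    (\<forall>i j. \<not> (i \<in> set rs \<and> j < n) \<longrightarrow> scal m' (k, i, j) = scal m (k, i, j))"
  let ?R = "\<lambda>(i, j) m'. scal m' (k, i, j) = (\<integral>\<gamma>. func m (f, i) \<gamma> * func m (g, j) \<gamma> \<partial>particle_measure)"
  have "\<exists>m'. run svd nuc N (gram_prog k f g t rs n) m = Some m' \<and> ?J m' \<and>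
    (\<forall>p\<in>set (List.product rs [0..<n]). ?R p m')"
    unfolding gram_prog_def
    by (rule run_independent) (use assms in \<open>auto simp: same_off_def write_simps\<close>)
  then show ?thesis by auto
qed

text \<open>The frame is finer than \<open>same_off\<close>: within matrix \<open>k\<close> only the
  entry \<open>c\<close> changes. Filling a matrix entry by entry relies on this.\<close>

lemma run_dot_prog:
  assumes "c = (k, k', k'')" "k \<noteq> t"
    and "\<And>i. a i \<noteq> c" "\<And>i. b i \<noteq> c" "\<And>i. fst (a i) \<noteq> t" "\<And>i. fst (b i) \<noteq> t"
  shows "\<exists>m'. run svd nuc N (dot_prog c t a b n) m = Some m' \<and> same_off {k, t} {} m m' \<and>
    (\<forall>x. x \<noteq> c \<longrightarrow> fst x \<noteq> t \<longrightarrow> scal m' x = scal m x) \<and>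
    scal m' c = (\<Sum>i<n. scal m (a i) * scal m (b i))"
proof -
  have ne: "a i \<noteq> (t, 0, 0)" "b i \<noteq> (t, 0, 0)" "c \<noteq> (t, 0, 0)" for i
    using assms by (metis fst_conv)+
  let ?I = "\<lambda>i m'. func m' = func m \<and> (\<forall>x. x \<noteq> c \<longrightarrow> fst x \<noteq> t \<longrightarrow> scal m' x = scal m x) \<and>
    scal m' c = (\<Sum>j<i. scal m (a j) * scal m (b j))"
  have "\<exists>m'. run svd nuc N (concat (map (\<lambda>i. [SMul (t, 0, 0) (a i) (b i), SAdd c c (t, 0, 0)]) [0..<n]))
      (write_scal c (scal m c - scal m c) m) = Some m' \<and> ?I n m'"
  proof (rule run_loop)
    fix i and m' :: memory assume *: "?I i m'"
    have "scal m' (a i) = scal m (a i)" "scal m' (b i) = scal m (b i)"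
      using *[THEN conjunct2, THEN conjunct1] assms(3-) by blast+
    then show "\<exists>m''. run svd nuc N [SMul (t, 0, 0) (a i) (b i), SAdd c c (t, 0, 0)] m' = Some m'' \<and> ?I (Suc i) m''"
      using * ne assms by (auto simp: write_simps)
  qed (simp add: write_simps)
  then show ?thesis
    using assms(1) by (auto simp: dot_prog_def same_off_def)
qed

lemma run_mat_prog:
  assumes "k \<noteq> t" "l \<noteq> k" "l \<noteq> t" "r \<noteq> k" "r \<noteq> t"
  shows "\<exists>m'. run svd nuc N (mat_prog k t l r n) m = Some m' \<and> same_off {k, t} {} m m' \<and>
    (\<forall>i<n. \<forall>j<n. scal m' (k, i, j) = (\<Sum>x<n. scal m (l, i, x) * scal m (r, x, j)))"
proof -
  let ?R = "\<lambda>(i, j) m'. scal m' (k, i, j) = (\<Sum>x<n. scal m (l, i, x) * scal m (r, x, j))"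
  have "\<exists>m'. run svd nuc N (mat_prog k t l r n) m = Some m' \<and> same_off {k, t} {} m m' \<and>
    (\<forall>p\<in>set (List.product [0..<n] [0..<n]). ?R p m')"
    unfolding mat_prog_def
  proof (rule run_independent)
    fix p m1 assume p: "p \<in> set (List.product [0..<n] [0..<n])" and J: "same_off {k, t} {} m m1"
    obtain i j where ij: "p = (i, j)" by force
    obtain m2 where m2: "run svd nuc N (dot_prog (k, p) t (\<lambda>x. (l, fst p, x)) (\<lambda>x. (r, x, snd p)) n) m1 = Some m2"
      "same_off {k, t} {} m1 m2" "\<forall>x. x \<noteq> (k, p) \<longrightarrow> fst x \<noteq> t \<longrightarrow> scal m2 x = scal m1 x"
      "scal m2 (k, p) = (\<Sum>x<n. scal m1 (l, fst p, x) * scal m1 (r, x, snd p))"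
      using run_dot_prog[of "(k, p)" k i j t "\<lambda>x. (l, fst p, x)" "\<lambda>x. (r, x, snd p)" svd nuc N n m1] assms ij
      by auto
    have "?R p m2" using m2(4) J assms by (simp add: ij same_off_scal)
    moreover have "?R q m2" if "?R q m1" for q
    proof (cases "q = p")
      case False
      then have "scal m2 (k, q) = scal m1 (k, q)" using m2(3) assms(1) by (cases q) auto
      then show ?thesis using that by (simp add: case_prod_beta)
    qed (use \<open>?R p m2\<close> in simp)
    ultimately show "\<exists>m2. run svd nuc N (dot_prog (k, p) t (\<lambda>x. (l, fst p, x)) (\<lambda>x. (r, x, snd p)) n) m1 = Some m2 \<and>
        same_off {k, t} {} m m2 \<and> ?R p m2 \<and> (\<forall>q\<in>set (List.product [0..<n] [0..<n]). ?R q m1 \<longrightarrow> ?R q m2)"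
      using m2(1) same_off_trans[OF J m2(2)] by blast
  qed simp
  then show ?thesis by auto
qed

lemma run_row_conj_prog:
  assumes "k \<noteq> l"
  shows "\<exists>m'. run svd nuc N (row_conj_prog k l c n) m = Some m' \<and> same_off {k} {} m m' \<and>
    (\<forall>i j. scal m' (k, i, j) = (if i = 0 \<and> j < n then cnj (scal m (l, j, c)) else scal m (k, i, j)))"
proof -
  let ?J = "\<lambda>m'. same_off {k} {} m m' \<and>
    (\<forall>i j. \<not> (i = 0 \<and> j < n) \<longrightarrow> scal m' (k, i, j) = scal m (k, i, j))"
  have "\<exists>m'. run svd nuc N (row_conj_prog k l c n) m = Some m' \<and> ?J m' \<and>
    (\<forall>j\<in>set [0..<n]. scal m' (k, 0, j) = cnj (scal m (l, j, c)))"
    unfolding row_conj_prog_def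
    by (rule run_independent) (use assms in \<open>auto simp: same_off_def write_simps\<close>)
  then show ?thesis by auto
qed

lemma run_fact_prog:
  assumes "c = (k, k', k'')" "t = (l, l', l'')" "u = (e, e', e'')" "k \<noteq> l" "k \<noteq> e" "l \<noteq> e"
    and "scal m u = 1"
  shows "\<exists>m'. run svd nuc N (fact_prog c t u n) m = Some m' \<and> same_off {k, l} {} m m' \<and> scal m' c = fact n"
proof -
  let ?m = "write_scal t 0 (write_scal c 1 m)"
  let ?I = "\<lambda>i m'. same_off {k, l} {} m m' \<and> scal m' t = of_nat i \<and> scal m' c = fact i"
  have "\<exists>m'. run svd nuc N (concat (map (\<lambda>i. [SAdd t t u, SMul c c t]) [0..<n])) ?m = Some m' \<and> ?I n m'"
  proof (rule run_loop)
    fix i and m' :: memory assume *: "?I i m'"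
    then have "scal m' u = 1" using assms by (auto simp: same_off_scal)
    then show "\<exists>m''. run svd nuc N [SAdd t t u, SMul c c t] m' = Some m'' \<and> ?I (Suc i) m''"
      using * assms by (auto simp: write_simps same_off_def algebra_simps)
  qed (use assms in \<open>auto simp: same_off_def write_simps\<close>)
  then show ?thesis by (auto simp: fact_prog_def)
qed

lemma run_comb_prog:
  assumes "k \<noteq> t" "\<And>i. fst (f i) \<noteq> t" "\<And>i. fst (f i) \<noteq> k"
  shows "\<exists>m'. run svd nuc N (comb_prog k t s f n) m = Some m' \<and> same_off {} {k, t} m m' \<and>
    func m' (k, 0) = (\<lambda>\<gamma>. func m (k, 0) \<gamma> + (\<Sum>i<n. scal m (s i) * func m (f i) \<gamma>))"
proof -
  let ?I = "\<lambda>i m'. scal m' = scal m \<and> (\<forall>x. fst x \<notin> {k, t} \<longrightarrow> func m' x = func m x) \<and>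
    func m' (k, 0) = (\<lambda>\<gamma>. func m (k, 0) \<gamma> + (\<Sum>j<i. scal m (s j) * func m (f j) \<gamma>))"
  have ne: "f i \<noteq> (t, 0)" "f i \<noteq> (k, 0)" for i
    using assms by (metis fst_conv)+
  have "\<exists>m'. run svd nuc N (comb_prog k t s f n) m = Some m' \<and> ?I n m'"
    unfolding comb_prog_def
  proof (rule run_loop)
    fix i and m' :: memory assume *: "?I i m'"
    then have f: "func m' (f i) = func m (f i)" using assms by blast
    show "\<exists>m''. run svd nuc N [FScale (t, 0) (s i) (f i), FAdd (k, 0) (k, 0) (t, 0)] m' = Some m'' \<and> ?I (Suc i) m''"
      using * assms(1) ne by (auto simp: write_simps add.assoc f)
  qed simp
  then show ?thesis by (auto simp: same_off_def)
qed

section \<open>Cost of the building blocks\<close>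

lemma program_cost_append [simp]:
  "program_cost N M (P @ Q) = program_cost N M P + program_cost N M Q"
  by (simp add: program_cost_def)

lemma program_cost_Nil [simp]: "program_cost N M [] = 0"
  by (simp add: program_cost_def)

lemma program_cost_Cons [simp]:
  "program_cost N M (c # P) = instr_cost N M c + program_cost N M P"
  by (simp add: program_cost_def)

lemma program_cost_concat_map:
  assumes "\<And>x. program_cost N M (P x) = c"
  shows "program_cost N M (concat (map P xs)) = length xs * c"
  by (induction xs) (simp_all add: assms)

lemma program_cost_blocks:
  "program_cost N M (conj_prog k l n) = n * M"
  "program_cost N M (op_prog k l n) = n * M"
  "program_cost N M (gram_prog k f g t rs n) = length rs * n * (2 * M)"
  "program_cost N M (dot_prog c t a b n) = 1 + n * 2"
  "program_cost N M (mat_prog k t l r n) = n * n * (1 + n * 2)"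
  "program_cost N M (row_conj_prog k l q n) = n"
  "program_cost N M (fact_prog c x u n) = 2 + n * 2"
  "program_cost N M (comb_prog k t s h n) = n * (2 * M)"
proof -
  show dot: "program_cost N M (dot_prog c t a b n) = 1 + n * 2" for c a b
    unfolding dot_prog_def by (simp add: program_cost_concat_map[where c = 2])
  show "program_cost N M (mat_prog k t l r n) = n * n * (1 + n * 2)"
    unfolding mat_prog_def by (subst program_cost_concat_map[OF dot]) simp
qed (simp_all del: concat_map_singleton add: conj_prog_def op_prog_def gram_prog_def row_conj_prog_def fact_prog_def comb_prog_def
    program_cost_concat_map[where c = M] program_cost_concat_map[where c = "2 * M"]
    program_cost_concat_map[where c = 1] program_cost_concat_map[where c = 2])

text \<open>Matrix 0 first holds the overlaps with first row 0; the last column of the factor \<open>V\<close> in matrix 3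
  is then a unit null vector, whose conjugate overwrites that row. Matrices 4, 7, 6, 11 hold the
  inverse \<open>B\<close>, the one-operator integrals \<open>H\<close>, the product \<open>Q = B H\<close> and \<open>Q V\<close>.\<close>

definition delta_prog :: "nat \<Rightarrow> instr list" where
  "delta_prog N =
     conj_prog 2 0 N @ op_prog 3 0 N @ conj_prog 4 3 N @
     gram_prog 0 1 2 9 [1..<N] N @ gram_prog 7 1 4 9 [0..<N] N @
     [MSvd 0 1 2 3] @ row_conj_prog 0 3 (N - 1) N @ [MInv 4 0, MDet (5, 0, 0) 0] @
     mat_prog 6 8 4 7 N @ [SOne (10, 0, 0)] @
     dot_prog (9, 0, 0) 8 (\<lambda>k. (6, k, k)) (\<lambda>k. (10, 0, 0)) N @
     mat_prog 11 8 6 3 N @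
     concat (map (\<lambda>j. [SMul (12, 0, j) (3, j, N - 1) (9, 0, 0), SSub (12, 0, j) (12, 0, j) (11, j, N - 1)]) [0..<N]) @
     fact_prog (14, 0, 0) (13, 0, 0) (10, 0, 0) N @ [SDiv (15, 0, 0) (5, 0, 0) (14, 0, 0)] @
     comb_prog 5 6 (\<lambda>j. (12, 0, j)) (\<lambda>j. (2, j)) N @
     comb_prog 5 6 (\<lambda>j. (3, j, N - 1)) (\<lambda>j. (4, j)) N @
     [FScale (7, 0) (15, 0, 0) (5, 0)]"

text \<open>The dominant terms are the two Gram matrices, at most \<open>2 * N ^ 2 * M\<close> each,
  the three built-in matrix routines and two schoolbook matrix products. All else is of lower order
  and is absorbed using \<open>1 \<le> N\<close>.\<close>

lemma program_cost_delta_prog: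
  assumes "1 \<le> N"
  shows "program_cost N M (delta_prog N) \<le> 40 * (N ^ 3 + N ^ 2 * M)"
proof -
  define a b where "a = N ^ 3" and "b = N ^ 2 * M"
  have "N * N * 1 \<le> N * N * N" "N * 1 * 1 \<le> N * N * N" "1 * 1 * 1 \<le> N * N * N"
    "N * 1 * M \<le> N * N * M" "1 * 1 * M \<le> N * N * M" "(N - 1) * N * M \<le> N * N * M"
    using assms by (intro mult_le_mono; simp)+
  then have bounds: "N * N \<le> a" "N \<le> a" "1 \<le> a" "N * M \<le> b" "M \<le> b" "(N - 1) * N * M \<le> b"
    by (simp_all only: a_def b_def power3_eq_cube power2_eq_square mult_1 mult_1_right)
  have "program_cost N M (delta_prog N) =
      7 * (N * M) + 2 * ((N - 1) * N * M) + 2 * b + M + (7 * a + 2 * (N * N) + 7 * N + 5)"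
    unfolding delta_prog_def
    by (simp add: program_cost_blocks program_cost_concat_map[where c = 2] a_def b_def
        power2_eq_square power3_eq_cube distrib_left mult_ac)
  also have "\<dots> \<le> 12 * b + 21 * a"
  proof (rule add_mono)
    show "7 * (N * M) + 2 * ((N - 1) * N * M) + 2 * b + M \<le> 12 * b" using bounds(4-6) by linarith
    show "7 * a + 2 * (N * N) + 7 * N + 5 \<le> 21 * a" using bounds(1-3) by linarith
  qed
  also have "\<dots> \<le> 40 * (a + b)" by simp
  finally show ?thesis by (simp add: a_def b_def)
qed

text \<open>The proof follows the program block by block; \<open>m0\<close> to \<open>m19\<close>
  are the memories in between, and the \<open>same_off\<close> facts carry earlier contents forward.
  The vector \<open>d'\<close> only witnesses nonsingularity; the program computes its own.\<close>

lemma run_delta_prog: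
  assumes N: "1 \<le> N" and svd: "svd_correct N svd" and adm: "admissible N nuc \<phi> \<phi>t"
    and ex: "unit_null_vector N \<phi> \<phi>t d'" "invertible_mat (E_matrix N \<phi> \<phi>t d')"
  shows "\<exists>m. run svd nuc N (delta_prog N) (input_memory N \<phi> \<phi>t) = Some m \<and>
    (\<forall>\<gamma>. (\<forall>j<N. one_op_defined_at nuc (\<phi> j) \<gamma>) \<longrightarrow>
      func m (7, 0) \<gamma> = delta_inner_A N \<phi>t (many_op N nuc (orb_product N \<phi>)) \<gamma>)"
proof -
  let ?n = "N - 1"
  have n: "?n < N" using N by simp
  define m0 where "m0 = input_memory N \<phi> \<phi>t"
  have m0: "scal m0 = (\<lambda>_. 0)" "\<And>i. i < N \<Longrightarrow> func m0 (0, i) = \<phi> i" "\<And>i. i < N \<Longrightarrow> func m0 (Suc 0, i) = \<phi>t i"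
    "\<And>k i. k \<ge> 2 \<Longrightarrow> func m0 (k, i) = (\<lambda>_. 0)"
    by (auto simp: m0_def input_memory_def)

  obtain m1 where m1: "run svd nuc N (conj_prog 2 0 N) m0 = Some m1" "same_off {} {2} m0 m1"
    "\<forall>i<N. func m1 (2, i) = (\<lambda>\<gamma>. cnj (func m0 (0, i) \<gamma>))"
    using run_conj_prog[of 2 0] by (metis zero_neq_numeral)
  have "one_op_defined nuc (func m1 (0, i))" if "i < N" for i
    using adm that m0(2) by (simp add: same_off_func[OF m1(2)] admissible_def)
  from run_op_prog[of 3 0 N nuc m1 svd N, OF _ this] obtain m2
    where m2: "run svd nuc N (op_prog 3 0 N) m1 = Some m2" "same_off {} {3} m1 m2"
      "\<forall>i<N. func m2 (3, i) = one_op nuc (func m1 (0, i))"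
    by auto
  obtain m3 where m3: "run svd nuc N (conj_prog 4 3 N) m2 = Some m3" "same_off {} {4} m2 m3"
    "\<forall>i<N. func m3 (4, i) = (\<lambda>\<gamma>. cnj (func m2 (3, i) \<gamma>))"
    using run_conj_prog[of 4 3 svd nuc N N m2] by auto
  have scal3: "scal m3 (k, i, j) = 0" for k i j
    by (simp add: same_off_scal[OF m1(2)] same_off_scal[OF m2(2)] same_off_scal[OF m3(2)] m0)
  have func3: "func m3 (Suc 0, i) = \<phi>t i" "func m3 (2, i) = (\<lambda>\<gamma>. cnj (\<phi> i \<gamma>))"
    "func m3 (4, i) = (\<lambda>\<gamma>. cnj (one_op nuc (\<phi> i) \<gamma>))" if "i < N" for i
    using that m1(3) m2(3) m3(3) m0
    by (simp_all add: same_off_func[OF m1(2)] same_off_func[OF m2(2)] same_off_func[OF m3(2)])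
  \<comment> \<open>Address \<open>(5, 0)\<close> still holds the zero function of the input memory,
    the starting value for the final linear combinations.\<close>
  have func3_5: "func m3 (5, 0) = (\<lambda>_. 0)"
    using m0(4) by (simp add: same_off_func[OF m1(2)] same_off_func[OF m2(2)] same_off_func[OF m3(2)])

  have "integrable particle_measure (\<lambda>\<gamma>. func m3 (1, i) \<gamma> * func m3 (2, j) \<gamma>)"
    if "i \<in> set [1..<N]" "j < N" for i j
    using that adm integrable_mult_cnj by (auto simp: func3 admissible_def)
  from run_gram_prog[of 9 1 2 "[1..<N]" N m3 svd nuc N 0, OF _ _ this] obtain m4
    where m4: "run svd nuc N (gram_prog 0 1 2 9 [1..<N] N) m3 = Some m4" "same_off {0} {9} m3 m4"
      "\<And>i j. scal m4 (0, i, j) = (if i \<in> set [1..<N] \<and> j < N then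
        \<integral>\<gamma>. func m3 (1, i) \<gamma> * func m3 (2, j) \<gamma> \<partial>particle_measure else scal m3 (0, i, j))"
    by auto
  have scal4: "scal m4 (0, i, j) = (if i = 0 then 0 else orb_inner (\<phi>t i) (\<phi> j))" if "i < N" "j < N" for i j
    using that by (auto simp: m4(3) scal3 func3 orb_inner_def)
  have func4: "func m4 (Suc 0, i) = \<phi>t i" "func m4 (2, i) = (\<lambda>\<gamma>. cnj (\<phi> i \<gamma>))"
    "func m4 (4, i) = (\<lambda>\<gamma>. cnj (one_op nuc (\<phi> i) \<gamma>))" if "i < N" for i
    using that by (simp_all add: same_off_func[OF m4(2)] func3)

  have "integrable particle_measure (\<lambda>\<gamma>. func m4 (1, i) \<gamma> * func m4 (4, j) \<gamma>)"
    if "i \<in> set [0..<N]" "j < N" for i j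
    using that adm by (auto simp: func4 admissible_def)
  from run_gram_prog[of 9 1 4 "[0..<N]" N m4 svd nuc N 7, OF _ _ this] obtain m5
    where m5: "run svd nuc N (gram_prog 7 1 4 9 [0..<N] N) m4 = Some m5" "same_off {7} {9} m4 m5"
      "\<And>i j. scal m5 (7, i, j) = (if i \<in> set [0..<N] \<and> j < N then
        \<integral>\<gamma>. func m4 (1, i) \<gamma> * func m4 (4, j) \<gamma> \<partial>particle_measure else scal m4 (7, i, j))"
    by auto
  have scal5: "scal m5 (0, i, j) = (if i = 0 then 0 else orb_inner (\<phi>t i) (\<phi> j))"
    "scal m5 (7, i, j) = one_op_matrix N nuc \<phi> \<phi>t $$ (i, j)" if "i < N" "j < N" for i j
    using that by (auto simp: m5(3) scal4 func4 same_off_scal[OF m5(2)] orb_inner_def one_op_matrix_def)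

  define A where "A = read_mat N 0 m5"
  have A: "A \<in> carrier_mat N N" by (simp add: A_def read_mat_def)
  have A_entry: "A $$ (i, j) = (if i = 0 then 0 else orb_inner (\<phi>t i) (\<phi> j))" if "i < N" "j < N" for i j
    using that by (simp add: A_def read_mat_def scal5)
  obtain U S V where USV: "svd A = (U, S, V)" by (cases "svd A")
  have is_svd: "is_svd N A (U, S, V)" using svd A USV by (auto simp: svd_correct_def)
  then have V: "V \<in> carrier_mat N N" by (simp add: is_svd_def)
  \<comment> \<open>Row 0 of matrix 0 was never written and is 0, so \<open>A\<close> is singular
    and its last right singular vector is a null vector.\<close>
  have "Determinant.det A = (\<Sum>j<N. A $$ (0, j) * cofactor A 0 j)"
    using N by (intro laplace_expansion_row[OF A]) simp
  also have "\<dots> = 0" using N by (intro sum.neutral) (simp add: A_entry)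
  finally have "Determinant.det A = 0" .
  note V_last = svd_last_column[OF N A is_svd this]
  define d where "d = col V ?n"
  have dc: "d \<in> carrier_vec N" using V by (simp add: d_def col_def)
  have dV: "d $ j = V $$ (j, ?n)" if "j < N" for j
    using that V n by (simp add: d_def)
  have d: "unit_null_vector N \<phi> \<phi>t d"
    unfolding unit_null_vector_def
  proof (intro conjI ballI)
    show "(\<Sum>j<N. (cmod (d $ j))\<^sup>2) = 1" using V_last(2) by (simp add: dV)
    fix i assume i: "i \<in> {1..<N}"
    have "(\<Sum>j<N. orb_inner (\<phi>t i) (\<phi> j) * d $ j) = (A *\<^sub>v d) $ i"
      using i A dc by (simp add: scalar_prod_def lessThan_atLeast0 A_entry)
    then show "(\<Sum>j<N. orb_inner (\<phi>t i) (\<phi> j) * d $ j) = 0"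
      using V_last(1) i by (simp add: d_def)
  qed (rule dc)
  let ?E = "E_matrix N \<phi> \<phi>t d"
  have E: "?E \<in> carrier_mat N N" by (simp add: E_matrix_def)
  have "E_matrix N \<phi> \<phi>t d' \<in> carrier_mat N N" by (simp add: E_matrix_def)
  \<comment> \<open>Nonsingularity is assumed for \<open>d'\<close> and passes to the computed
    \<open>d\<close>, so that \<open>MInv\<close> succeeds.\<close>
  from det_E_matrix_nonzero_cong[OF N d ex(1) invertible_mat_det_nonzero[OF this ex(2)]]
  have "Determinant.det ?E \<noteq> 0" .
  from mat_inverse_det_nonzero[OF E this] obtain B where
    B: "mat_inverse ?E = Some B" "B \<in> carrier_mat N N" "?E * B = 1\<^sub>m N"
    by blast

  define m6 where "m6 = write_mat N 3 V (write_mat N 2 S (write_mat N 1 U m5))"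
  have m6: "run svd nuc N [MSvd 0 1 2 3] m5 = Some m6"
    by (simp add: m6_def USV A_def[symmetric])
  have off6: "same_off {1, 2, 3} {} m5 m6"
    by (auto simp: m6_def write_mat_def same_off_def)
  have scal6: "scal m6 (3, i, j) = V $$ (i, j)" if "i < N" "j < N" for i j
    using that by (simp add: m6_def write_mat_def)

  obtain m7 where m7: "run svd nuc N (row_conj_prog 0 3 ?n N) m6 = Some m7" "same_off {0} {} m6 m7"
    "\<And>i j. scal m7 (0, i, j) = (if i = 0 \<and> j < N then cnj (scal m6 (3, j, ?n)) else scal m6 (0, i, j))"
    using run_row_conj_prog[of 0 3 svd nuc N ?n N m6] by auto
  have E7: "read_mat N 0 m7 = ?E"
    using n by (intro eq_matI)
      (auto simp: read_mat_def E_matrix_def m7(3) scal6 dV same_off_scal[OF off6] scal5)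

  define m8 where "m8 = write_mat N 4 B m7"
  define m9 where "m9 = write_scal (5, 0, 0) (Determinant.det ?E) m8"
  have off8: "same_off {4} {} m7 m8" and off9: "same_off {5} {} m8 m9"
    by (auto simp: m8_def m9_def write_mat_def write_scal_def same_off_def)
  have "read_mat N 0 m8 = read_mat N 0 m7"
    by (simp add: read_mat_def same_off_scal[OF off8])
  then have m9: "run svd nuc N [MInv 4 0, MDet (5, 0, 0) 0] m7 = Some m9"
    by (simp add: E7 B(1) m8_def[symmetric] m9_def)
  have scal9: "scal m9 (4, i, j) = B $$ (i, j)" "scal m9 (7, i, j) = one_op_matrix N nuc \<phi> \<phi>t $$ (i, j)"
    "scal m9 (3, i, j) = V $$ (i, j)" "scal m9 (5, 0, 0) = Determinant.det ?E" if "i < N" "j < N" for i j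
    using that
    by (simp_all add: same_off_scal[OF off8] same_off_scal[OF off9] same_off_scal[OF m7(2)] scal6
        same_off_scal[OF off6] scal5) (simp_all add: m8_def m9_def write_mat_def write_scal_def)
  have func9: "func m9 (k, i) = func m3 (k, i)" if "k \<noteq> 9" for k i
    using that by (simp add: same_off_func[OF off9] same_off_func[OF off8] same_off_func[OF m7(2)]
        same_off_func[OF off6] same_off_func[OF m5(2)] same_off_func[OF m4(2)])

  define Q where "Q = B * one_op_matrix N nuc \<phi> \<phi>t"
  have Q: "Q $$ (i, j) = (\<Sum>x<N. B $$ (i, x) * one_op_matrix N nuc \<phi> \<phi>t $$ (x, j))" if "i < N" "j < N" for i j
    using that B(2) by (simp add: Q_def one_op_matrix_def scalar_prod_def lessThan_atLeast0)
  obtain m10 where m10: "run svd nuc N (mat_prog 6 8 4 7 N) m9 = Some m10" "same_off {6, 8} {} m9 m10"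
    "\<forall>i<N. \<forall>j<N. scal m10 (6, i, j) = (\<Sum>x<N. scal m9 (4, i, x) * scal m9 (7, x, j))"
    using run_mat_prog[of 6 8 4 7 svd nuc N N m9] by auto
  have scal10: "scal m10 (6, i, j) = Q $$ (i, j)" if "i < N" "j < N" for i j
    using that m10(3) by (simp add: scal9 Q)

  define m11 where "m11 = write_scal (10, 0, 0) 1 m10"
  have m11: "run svd nuc N [SOne (10, 0, 0)] m10 = Some m11" by (simp add: m11_def)
  have off11: "same_off {10} {} m10 m11" and scal11: "scal m11 (10, 0, 0) = 1"
    by (auto simp: m11_def write_scal_def same_off_def)

  \<comment> \<open>The trace of \<open>Q\<close>, as the dot product of its diagonal with the
    constant 1.\<close>
  obtain m12 where m12: "run svd nuc N (dot_prog (9, 0, 0) 8 (\<lambda>k. (6, k, k)) (\<lambda>k. (10, 0, 0)) N) m11 = Some m12"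
    "same_off {9, 8} {} m11 m12"
    "scal m12 (9, 0, 0) = (\<Sum>k<N. scal m11 (6, k, k) * scal m11 (10, 0, 0))"
    using run_dot_prog[of "(9, 0, 0)" 9 0 0 8 "\<lambda>k. (6, k, k)" "\<lambda>k. (10, 0, 0)" svd nuc N N m11] by auto
  have scal12: "scal m12 (9, 0, 0) = (\<Sum>k<N. Q $$ (k, k))"
    by (simp add: m12(3) scal11 same_off_scal[OF off11] scal10)

  \<comment> \<open>Matrix 3 still holds \<open>V\<close>; only the last column of the product,
    which is \<open>Q\<close> applied to \<open>d\<close>, is read later.\<close>
  obtain m13 where m13: "run svd nuc N (mat_prog 11 8 6 3 N) m12 = Some m13" "same_off {11, 8} {} m12 m13"
    "\<forall>i<N. \<forall>j<N. scal m13 (11, i, j) = (\<Sum>x<N. scal m12 (6, i, x) * scal m12 (3, x, j))"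
    using run_mat_prog[of 11 8 6 3 svd nuc N N m12] by auto
  have scal13: "scal m13 (11, j, ?n) = (\<Sum>k<N. Q $$ (j, k) * d $ k)" "scal m13 (9, 0, 0) = (\<Sum>k<N. Q $$ (k, k))"
    "scal m13 (3, j, ?n) = d $ j" if "j < N" for j
    using that n m13(3)
    by (simp_all add: same_off_scal[OF m13(2)] scal12 same_off_scal[OF m12(2)] same_off_scal[OF off11]
        scal10 same_off_scal[OF m10(2)] scal9 dV)

  let ?coef = "\<lambda>j. d $ j * (\<Sum>k<N. Q $$ (k, k)) - (\<Sum>k<N. Q $$ (j, k) * d $ k)"
  have "\<exists>m14. run svd nuc N
      (concat (map (\<lambda>j. [SMul (12, 0, j) (3, j, ?n) (9, 0, 0), SSub (12, 0, j) (12, 0, j) (11, j, ?n)]) [0..<N])) m13 = Some m14 \<and>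
      same_off {12} {} m13 m14 \<and> (\<forall>j\<in>set [0..<N]. scal m14 (12, 0, j) = ?coef j)"
    by (rule run_independent) (auto simp: same_off_def write_simps scal13[unfolded One_nat_def])
  then obtain m14 where m14: "run svd nuc N
      (concat (map (\<lambda>j. [SMul (12, 0, j) (3, j, ?n) (9, 0, 0), SSub (12, 0, j) (12, 0, j) (11, j, ?n)]) [0..<N])) m13 = Some m14"
      "same_off {12} {} m13 m14" "\<And>j. j < N \<Longrightarrow> scal m14 (12, 0, j) = ?coef j"
    by auto
  have "scal m14 (10, 0, 0) = 1"
    by (simp add: same_off_scal[OF m14(2)] same_off_scal[OF m13(2)] same_off_scal[OF m12(2)] scal11)
  from run_fact_prog[of "(14, 0, 0)" 14 0 0 "(13, 0, 0)" 13 0 0 "(10, 0, 0)" 10 0 0 m14 svd nuc N N, OF _ _ _ _ _ _ this]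
  obtain m15 where m15: "run svd nuc N (fact_prog (14, 0, 0) (13, 0, 0) (10, 0, 0) N) m14 = Some m15"
    "same_off {14, 13} {} m14 m15" "scal m15 (14, 0, 0) = fact N"
    by auto
  define m16 where "m16 = write_scal (15, 0, 0) (Determinant.det ?E / fact N) m15"
  have "scal m15 (5, 0, 0) = Determinant.det ?E"
    using N by (simp add: same_off_scal[OF m15(2)] same_off_scal[OF m14(2)] same_off_scal[OF m13(2)]
        same_off_scal[OF m12(2)] same_off_scal[OF off11] same_off_scal[OF m10(2)] scal9(4)[of 0 0])
  then have m16: "run svd nuc N [SDiv (15, 0, 0) (5, 0, 0) (14, 0, 0)] m15 = Some m16"
    by (simp add: m15(3) m16_def)
  have off16: "same_off {15} {} m15 m16" and scal16: "scal m16 (15, 0, 0) = Determinant.det ?E / fact N"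
    by (auto simp: m16_def write_scal_def same_off_def)
  have func16: "func m16 (k, i) = func m3 (k, i)" if "k \<noteq> 9" for k i
    using that by (simp add: same_off_func[OF off16] same_off_func[OF m15(2)] same_off_func[OF m14(2)]
        same_off_func[OF m13(2)] same_off_func[OF m12(2)] same_off_func[OF off11] same_off_func[OF m10(2)] func9)
  have scal16': "scal m16 (12, 0, j) = ?coef j" "scal m16 (3, j, ?n) = d $ j" if "j < N" for j
    using that by (simp_all add: same_off_scal[OF off16] same_off_scal[OF m15(2)] m14(3) same_off_scal[OF m14(2)] scal13[unfolded One_nat_def])

  obtain m17 where m17: "run svd nuc N (comb_prog 5 6 (\<lambda>j. (12, 0, j)) (\<lambda>j. (2, j)) N) m16 = Some m17"
    "same_off {} {5, 6} m16 m17"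
    "func m17 (5, 0) = (\<lambda>\<gamma>. func m16 (5, 0) \<gamma> + (\<Sum>i<N. scal m16 (12, 0, i) * func m16 (2, i) \<gamma>))"
    using run_comb_prog[of 5 6 "\<lambda>j. (2, j)" svd nuc N "\<lambda>j. (12, 0, j)" N m16] by auto
  obtain m18 where m18: "run svd nuc N (comb_prog 5 6 (\<lambda>j. (3, j, ?n)) (\<lambda>j. (4, j)) N) m17 = Some m18"
    "same_off {} {5, 6} m17 m18"
    "func m18 (5, 0) = (\<lambda>\<gamma>. func m17 (5, 0) \<gamma> + (\<Sum>i<N. scal m17 (3, i, ?n) * func m17 (4, i) \<gamma>))"
    using run_comb_prog[of 5 6 "\<lambda>j. (4, j)" svd nuc N "\<lambda>j. (3, j, ?n)" N m17] by auto
  define m19 where "m19 = write_func (7, 0) (\<lambda>\<gamma>. scal m18 (15, 0, 0) * func m18 (5, 0) \<gamma>) m18"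
  have m19: "run svd nuc N [FScale (7, 0) (15, 0, 0) (5, 0)] m18 = Some m19" by (simp add: m19_def)
  have out: "func m19 (7, 0) \<gamma> = Determinant.det ?E / fact N *
      ((\<Sum>j<N. cnj (\<phi> j \<gamma>) * ?coef j) + (\<Sum>k<N. cnj (one_op nuc (\<phi> k) \<gamma>) * d $ k))" for \<gamma>
    by (simp add: m19_def write_func_def same_off_scal[OF m18(2)] same_off_scal[OF m17(2)] scal16
        m18(3) m17(3) func16 func3_5 scal16'[unfolded One_nat_def] func3 same_off_func[OF m17(2)] mult.commute)
  have "run svd nuc N (delta_prog N) m0 = Some m19"
    unfolding delta_prog_def run_append m1 m2 m3 m4(1) m5(1) m6 m7(1) m9 m10(1) m11 m12(1) m13(1) m14(1)
      m15(1) m16 m17(1) m18(1) m19 Option.bind.bind_lunit ..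
  \<comment> \<open>The quantity computed does not mention \<open>d\<close>, so the formula for the
    program's own \<open>d\<close> proves correctness, whichever decomposition the routine
    returned.\<close>
  then show ?thesis
    using delta_inner_A_formula[OF N adm d B(2,3), folded Q_def] out unfolding m0_def by auto
qed

text \<open>In the cost claim the constant is fixed before \<open>N\<close>, and the program depends
  on \<open>N\<close> alone: it is chosen before the orbitals, the nuclei, \<open>M\<close> and the
  singular value routine.\<close>

theorem proposition15:
  shows
    "(\<forall>N \<ge> 1. \<forall>(nuc :: nuclei) (\<phi> :: nat \<Rightarrow> orbital) (\<phi>t :: nat \<Rightarrow> orbital) (d :: complex vec) (\<gamma> :: particle).
        admissible N nuc \<phi> \<phi>t \<longrightarrow>
        unit_null_vector N \<phi> \<phi>t d \<longrightarrow>
        invertible_mat (E_matrix N \<phi> \<phi>t d) \<longrightarrow>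
        \<gamma> \<in> space particle_measure \<longrightarrow>
        (\<forall>j<N. one_op_defined_at nuc (\<phi> j) \<gamma>) \<longrightarrow>
        delta_inner_A N \<phi>t (many_op N nuc (orb_product N \<phi>)) \<gamma> =
          Determinant.det (E_matrix N \<phi> \<phi>t d) / fact N *
          ((\<Sum>j<N. cnj (\<phi> j \<gamma>) *
              (d $ j * (\<integral>\<gamma>'. (\<Sum>k<N. cnj (one_op nuc (\<phi> k) \<gamma>') * Theta N \<phi> \<phi>t d k \<gamma>') \<partial>particle_measure)
               - (\<integral>\<gamma>'. one_op nuc (\<lambda>\<gamma>''. \<Sum>k<N. cnj (\<phi> k \<gamma>'') * d $ k) \<gamma>' * Theta N \<phi> \<phi>t d j \<gamma>' \<partial>particle_measure)))
           + one_op nuc (\<lambda>\<gamma>''. \<Sum>k<N. cnj (\<phi> k \<gamma>'') * d $ k) \<gamma>))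
     \<and>
     (\<exists>C :: nat. \<forall>N \<ge> 1. \<exists>(P :: instr list) (out :: faddr).
        (\<forall>M \<ge> N. program_cost N M P \<le> C * (N ^ 3 + N ^ 2 * M)) \<and>
        (\<forall>svd nuc \<phi> \<phi>t.
           svd_correct N svd \<longrightarrow>
           admissible N nuc \<phi> \<phi>t \<longrightarrow>
           (\<exists>d. unit_null_vector N \<phi> \<phi>t d \<and> invertible_mat (E_matrix N \<phi> \<phi>t d)) \<longrightarrow>
           (\<exists>m. run svd nuc N P (input_memory N \<phi> \<phi>t) = Some m \<and>
              (\<forall>\<gamma> \<in> space particle_measure. (\<forall>j<N. one_op_defined_at nuc (\<phi> j) \<gamma>) \<longrightarrow>
                 func m out \<gamma> = delta_inner_A N \<phi>t (many_op N nuc (orb_product N \<phi>)) \<gamma>))))"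
  (is "?formula \<and> (\<exists>C. \<forall>N\<ge>1. \<exists>P out. ?cost C N P \<and> ?correct N P out)")
proof
  show ?formula using delta_inner_A_Theta by blast
  \<comment> \<open>40 is the constant of the cost bound, and \<open>(7, 0)\<close> is the
    destination of the last instruction of \<open>delta_prog\<close>.\<close>
  have "?cost 40 N (delta_prog N) \<and> ?correct N (delta_prog N) (7, 0)" if "1 \<le> N" for N
    using program_cost_delta_prog[OF that] run_delta_prog[OF that] by blast
  then show "\<exists>C. \<forall>N\<ge>1. \<exists>P out. ?cost C N P \<and> ?correct N P out" by blast
qed

end
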